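(* Let $q$ be a power of a prime $p$, $s\ge1$, and let $N>1$ be an integer with $N-1\mid q^s-1$ and $p\mid N$. Let $\Delta$ be a nonempty subset of $\{0,1,\dots,N-1\}$ with $0\in\Delta$ and let $d=d(\Delta)=\max\Delta$. For each relevant $a$ (that is, $a\in\mathcal{A}$, and $a=N-1-d$), let $\xi_a$ be a primitive element of the field $\mathbb{F}_{q^{n_a}}$ with $\mathcal{T}_a(\xi_a)\neq0$. Then a basis of the $\mathbb{F}_q$-vector space $(\mathrm{PRS}(N,\Delta)_q)^\perp$ is given by the image under $\mathrm{ev}_{X_N}$ of the following polynomials. If $\mathfrak{I}_d\subset\Delta$: $$\bigcup_{a\in \mathcal{A},\ \mathfrak{I}_a\cap \Delta^\perp \neq \emptyset}\{\mathcal{T}_a(\xi_a^r x_0 x_1^a)\mid 0\leq r\leq n_a-1 \}\cup \{ \mathcal{T}_{N-1-d}(\xi_{N-1-d}^r x_1^{N-1-d}) \mid 0\leq r \leq n_{N-1-d}-1\}.$$ If $\mathfrak{I}_d\not\subset\Delta$: $$\bigcup_{a\in \mathcal{A},\ \mathfrak{I}_a\cap \Delta^\perp \neq \emptyset}\{\mathcal{T}_a(\xi_a^r x_0 x_1^a)\mid 0\leq r\leq n_a-1 \}\cup \{ \mathcal{T}_{N-1-d}(\xi_{N-1-d} x_1^{N-1-d})\}.$$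
   Context: Points and codes. $Y_N=\{z\in\mathbb{F}_{q^s}: z^N=z\}$ (it has $N$ elements), and $X_N=\{(1,z): z\in Y_N\}\cup\{(0,1)\}\subset \mathbb{F}_{q^s}^2$. For $f\in\mathbb{F}_{q^s}[x_0,x_1]$, $\mathrm{ev}_{X_N}(f)=(f(P))_{P\in X_N}\in\mathbb{F}_{q^s}^{N+1}$ (with $0^0=1$). $\mathrm{PRS}(N,\Delta)$ is the $\mathbb{F}_{q^s}$-linear code spanned by $\{\mathrm{ev}_{X_N}(x_0^{d(\Delta)-i}x_1^i): i\in\Delta\}$, and $\mathrm{PRS}(N,\Delta)_q=\mathrm{PRS}(N,\Delta)\cap\mathbb{F}_q^{N+1}$; $(\mathrm{PRS}(N,\Delta)_q)^\perp\subset\mathbb{F}_q^{N+1}$ is its Euclidean dual. $\Delta^\perp=\{\alpha\in\{0,1,\dots,N-1\}: \alpha\neq N-1-h \text{ for all } h\in\Delta\}$. Cyclotomic sets. Let $\mathbb{Z}_N=\{0\}\cup\mathbb{Z}/\langle N-1\rangle$, where the classes of $\mathbb{Z}/\langle N-1\rangle$ are represented by $\{1,\dots,N-1\}$ (so $0$ and $N-1$ are distinct and $q\cdot0=0$); thus $\mathbb{Z}_N$ is identified with $\{0,1,\dots,N-1\}$. For $z\in\mathbb{Z}_N$, $\mathfrak{I}_z=\{q^i\cdot z: i\ge 0\}$ is the minimal cyclotomic set of $z$ with respect to $q$, and $n_z=|\mathfrak{I}_z|$. $\mathcal{A}$ is the set of minimal representatives (least elements) of the minimal cyclotomic sets. Traces.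 For $a\in\mathbb{Z}_N$ and $f\in\mathbb{F}_{q^s}[x_0,x_1]$ (in particular for $f$ a constant), $\mathcal{T}_a(f)=f+f^q+\cdots+f^{q^{n_a-1}}$ (polynomials may be taken modulo the vanishing ideal of $X_N$). A primitive element $\xi_a$ of $\mathbb{F}_{q^{n_a}}$ with $\mathcal{T}_a(\xi_a)\ne0$ always exists. *)

theory Defs
  imports
    "HOL-Library.Cardinality"
    "HOL-Library.Function_Algebras"
    "HOL-Computational_Algebra.Polynomial"
    "HOL-Computational_Algebra.Primes"
begin

text \<open>
  The extension of finite fields is modelled by two finite field types and an embedding of the
  smaller one, so that the linear algebra over either field is that of \<^theory>\<open>HOL.Modules\<close>.
\<close>

definition field_embedding :: "('k::field \<Rightarrow> 'a::field) \<Rightarrow> bool" where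
  "field_embedding \<iota> \<longleftrightarrow>
     \<iota> 1 = 1 \<and> (\<forall>x y. \<iota> (x + y) = \<iota> x + \<iota> y) \<and> (\<forall>x y. \<iota> (x * y) = \<iota> x * \<iota> y)"

text \<open>
  If a finite field contains a subfield with \<open>m\<close> elements, it is unique and consists of the
  roots of \<open>x ^ m - x\<close>.
\<close>

definition subfield_of_order :: "nat \<Rightarrow> 'a::field set" where
  "subfield_of_order m = {x. x ^ m = x}"

text \<open>Primitive in the sense of finite fields: a generator of the multiplicative group.\<close>

definition primitive_element :: "'a::field set \<Rightarrow> 'a \<Rightarrow> bool" where
  "primitive_element K \<xi> \<longleftrightarrow> \<xi> \<in> K \<and> K - {0} = range (\<lambda>i::nat. \<xi> ^ i)"

definition vscale :: "('k::field \<Rightarrow> 'a::field) \<Rightarrow> 'k \<Rightarrow> ('i \<Rightarrow> 'a) \<Rightarrow> 'i \<Rightarrow> 'a" where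
  "vscale \<iota> c v = (\<lambda>P. \<iota> c * v P)"

lemma vector_space_vscale:
  assumes "field_embedding \<iota>"
  shows "vector_space (vscale \<iota>)"
  using assms
  by unfold_locales (auto simp: vscale_def field_embedding_def fun_eq_iff algebra_simps)

lemma field_embedding_id: "field_embedding (\<lambda>x. x)"
  by (simp add: field_embedding_def)

definition is_basis_over ::
    "('k::field \<Rightarrow> 'a::field) \<Rightarrow> ('i \<Rightarrow> 'a) set \<Rightarrow> ('i \<Rightarrow> 'a) set \<Rightarrow> bool" where
  "is_basis_over \<iota> V B \<longleftrightarrow>
     \<not> module.dependent (vscale \<iota>) B \<and> module.span (vscale \<iota>) B = V"

definition Y_pts :: "nat \<Rightarrow> 'a::field set" where
  "Y_pts N = {z. z ^ N = z}"

definition X_pts :: "nat \<Rightarrow> ('a::field \<times> 'a) set" where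
  "X_pts N = {(1, z) | z. z \<in> Y_pts N} \<union> {(0, 1)}"

text \<open>
  Polynomials in \<open>x\<^sub>0, x\<^sub>1\<close> are polynomials in \<open>x\<^sub>1\<close> whose coefficients are polynomials
  in \<open>x\<^sub>0\<close>.
\<close>

definition x0 :: "'a::field poly poly" where "x0 = [:[:0, 1:]:]"

definition x1 :: "'a::field poly poly" where "x1 = [:0, 1:]"

definition const2 :: "'a::field \<Rightarrow> 'a poly poly" where "const2 c = [:[:c:]:]"

definition eval2 :: "'a::field poly poly \<Rightarrow> 'a \<times> 'a \<Rightarrow> 'a" where
  "eval2 f P = poly (poly f [:snd P:]) (fst P)"

lemma eval2_x0 [simp]: "eval2 x0 P = fst P"
  and eval2_x1 [simp]: "eval2 x1 P = snd P"
  and eval2_const2 [simp]: "eval2 (const2 c) P = c"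
  and eval2_add [simp]: "eval2 (f + g) P = eval2 f P + eval2 g P"
  and eval2_mult [simp]: "eval2 (f * g) P = eval2 f P * eval2 g P"
  by (simp_all add: eval2_def x0_def x1_def const2_def)

text \<open>
  A vector whose coordinates are indexed by the points of \<open>X_pts N\<close> is a function on all pairs
  that vanishes outside \<open>X_pts N\<close>.
\<close>

definition ev :: "nat \<Rightarrow> 'a::field poly poly \<Rightarrow> 'a \<times> 'a \<Rightarrow> 'a" where
  "ev N f = (\<lambda>P. if P \<in> X_pts N then eval2 f P else 0)"

definition PRS :: "nat \<Rightarrow> nat set \<Rightarrow> ('a::field \<times> 'a \<Rightarrow> 'a) set" where
  "PRS N \<Delta> = module.span (vscale (\<lambda>x. x)) {ev N (x0 ^ (Max \<Delta> - i) * x1 ^ i) | i. i \<in> \<Delta>}"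

definition subfield_vectors ::
    "('k::field \<Rightarrow> 'a::field) \<Rightarrow> nat \<Rightarrow> ('a \<times> 'a \<Rightarrow> 'a) set" where
  "subfield_vectors \<iota> N =
     {v. (\<forall>P\<in>X_pts N. v P \<in> range \<iota>) \<and> (\<forall>P. P \<notin> X_pts N \<longrightarrow> v P = 0)}"

definition PRS_subfield ::
    "('k::field \<Rightarrow> 'a::field) \<Rightarrow> nat \<Rightarrow> nat set \<Rightarrow> ('a \<times> 'a \<Rightarrow> 'a) set" where
  "PRS_subfield \<iota> N \<Delta> = PRS N \<Delta> \<inter> subfield_vectors \<iota> N"

definition dual_code ::
    "('k::field \<Rightarrow> 'a::field) \<Rightarrow> nat \<Rightarrow> ('a \<times> 'a \<Rightarrow> 'a) set \<Rightarrow> ('a \<times> 'a \<Rightarrow> 'a) set" where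
  "dual_code \<iota> N C =
     {v \<in> subfield_vectors \<iota> N. \<forall>c\<in>C. (\<Sum>P\<in>X_pts N. v P * c P) = 0}"

definition Delta_perp :: "nat \<Rightarrow> nat set \<Rightarrow> nat set" where
  "Delta_perp N \<Delta> = {\<alpha> \<in> {0..N - 1}. \<forall>h\<in>\<Delta>. \<alpha> \<noteq> N - 1 - h}"

text \<open>
  The element of \<open>{0..N - 1}\<close> representing \<open>m\<close>: the number \<open>0\<close> is kept apart, and every
  \<open>m > 0\<close> is reduced modulo \<open>N - 1\<close> into \<open>{1..N - 1}\<close>.
\<close>

definition Z_rep :: "nat \<Rightarrow> nat \<Rightarrow> nat" where
  "Z_rep N m = (if m = 0 then 0 else (m - 1) mod (N - 1) + 1)"

definition cyc :: "nat \<Rightarrow> nat \<Rightarrow> nat \<Rightarrow> nat set" where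
  "cyc q N z = range (\<lambda>i. Z_rep N (q ^ i * z))"

definition cyc_card :: "nat \<Rightarrow> nat \<Rightarrow> nat \<Rightarrow> nat" where
  "cyc_card q N z = card (cyc q N z)"

definition min_reps :: "nat \<Rightarrow> nat \<Rightarrow> nat set" where
  "min_reps q N = {Min (cyc q N z) | z. z \<in> {0..N - 1}}"

definition cyc_trace :: "nat \<Rightarrow> nat \<Rightarrow> nat \<Rightarrow> 'b::comm_semiring_1 \<Rightarrow> 'b" where
  "cyc_trace q N a f = (\<Sum>i<cyc_card q N a. f ^ (q ^ i))"

end

theory Submission
  imports Defs "HOL-Library.FuncSet" "HOL-Number_Theory.Cong"
begin

text \<open>
  A vector on \<open>X_pts N\<close> is a pair: the coefficients of the polynomial of degree less than \<open>N\<close>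
  interpolating its affine part, and its value at \<open>(0, 1)\<close>. Since \<open>p\<close> divides \<open>N\<close>, the power sum
  of exponent \<open>k\<close> over \<open>Y_pts N\<close> is \<open>-1\<close> when \<open>k\<close> is a positive multiple of \<open>N - 1\<close> and \<open>0\<close>
  otherwise, so the pairing of affine parts matches the coefficient at \<open>j\<close> with the one at
  \<open>N - 1 - j\<close>, up to a correction at \<open>N - 1\<close>. Coordinates lie in the small field only if
  multiplying the index by \<open>q\<close> raises the coefficient to the power \<open>q\<close>; hence a codeword is
  supported on full cyclotomic sets inside \<open>\<Delta>\<close> and is determined by one coefficient on each.
  Testing a dual vector against trace codewords with nonzero trace kills all its coefficients
  outside the cyclotomic sets of \<open>N - 1 - d\<close> and of the elements of \<open>Delta_perp\<close>. On each
  remaining set its coefficient lies in the field of \<open>q ^ n\<close> elements, of which the powers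
  \<open>\<xi> ^ r\<close> with \<open>r < n\<close> are a basis over the small field.
\<close>

section \<open>Roots in finite fields\<close>

text \<open>Multiplication by a nonzero \<open>x\<close> permutes the units, so comparing the
  products over all units gives \<open>x ^ (CARD('a) - 1) = 1\<close>.\<close>

lemma power_card_UNIV_eq_same:
  fixes x :: "'a::{field,finite}"
  shows "x ^ CARD('a) = x"
proof (cases "x = 0")
  case False
  have "(\<Prod>y\<in>UNIV-{0}. x * y) = (\<Prod>y\<in>UNIV-{0}. y)"
    by (rule prod.reindex_bij_witness[of _ "\<lambda>y. y / x" "\<lambda>y. x * y"]) (use False in auto)
  then have "x ^ (CARD('a) - 1) = 1"
    by (simp add: prod.distrib card_Diff_singleton)
  then show ?thesis
    by (metis One_nat_def Suc_pred finite_UNIV_card_ge_0 finite mult.right_neutral power_Suc)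
qed (auto simp: card_gt_0_iff)

lemma card_roots_binomial_le:
  fixes b :: "'a::idom"
  assumes "n > 0"
  shows "finite {x. x ^ n = b}" "card {x. x ^ n = b} \<le> n"
proof -
  let ?P = "monom 1 n - [:b:]"
  have "coeff ?P n = 1"
    using assms by (simp add: coeff_pCons split: nat.splits)
  then have "?P \<noteq> 0" by (metis coeff_0 zero_neq_one)
  moreover have "{x. poly ?P x = 0} = {x. x ^ n = b}"
    by (auto simp: poly_monom)
  moreover have "degree ?P \<le> n"
    by (intro degree_diff_le) (auto simp: degree_monom_le)
  ultimately show "finite {x. x ^ n = b}" "card {x. x ^ n = b} \<le> n"
    using poly_roots_finite[of ?P] card_poly_roots_bound[of ?P] by auto
qed

lemma card_fixed_power_le:
  fixes n :: nat
  assumes "n > 1"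
  shows "finite {x::'a::idom. x ^ n = x}" "card {x::'a::idom. x ^ n = x} \<le> n"
proof -
  have *: "{x::'a. x ^ n = x} = insert 0 {x. x ^ (n - 1) = 1}"
  proof -
    have "x ^ n = x * x ^ (n - 1)" for x :: 'a
      using assms by (metis One_nat_def Suc_pred gr0I less_zeroE power_Suc)
    then show ?thesis by auto
  qed
  show "finite {x::'a. x ^ n = x}" "card {x::'a. x ^ n = x} \<le> n"
    using card_roots_binomial_le[of "n - 1" "1::'a"] assms unfolding *
    by (auto intro: order_trans[OF card_insert_le_m1])
qed

lemma card_roots_of_unity_finite_field:
  fixes e :: nat
  assumes "e > 0" and "e dvd CARD('a::{field,finite}) - 1"
  shows "card {x::'a. x ^ e = 1} = e"
proof (rule antisym)
  show "card {x::'a. x ^ e = 1} \<le> e"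
    using card_roots_binomial_le[OF assms(1)] by blast
next
  obtain k where k: "CARD('a) - 1 = e * k" using assms(2) by blast
  have "CARD('a) > 1"
    using card_mono[of UNIV "{0, 1::'a}"] by simp
  then have kpos: "k > 0" using k by (cases k) auto
  have one: "x ^ (e * k) = 1" if "x \<noteq> 0" for x :: 'a
  proof -
    have "x * x ^ (e * k) = x * 1"
      using power_card_UNIV_eq_same[of x] \<open>CARD('a) > 1\<close> unfolding k[symmetric]
      by (metis One_nat_def Suc_pred gr0I less_zeroE mult.right_neutral power_Suc)
    then show ?thesis using that by simp
  qed
  let ?G = "UNIV - {0::'a}"
  let ?f = "\<lambda>x::'a. x ^ e"
  \<comment> \<open>the fibres of the power map on the unit group have at most as many elements as its kernel,
    and its image has at most \<open>k\<close> elements\<close>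
  have fib: "card {x \<in> ?G. ?f x = y} \<le> card {x::'a. x ^ e = 1}" if y: "y \<in> ?f ` ?G" for y
  proof -
    obtain x0 where x0: "x0 \<noteq> 0" "y = x0 ^ e" using y by auto
    show ?thesis
    proof (rule card_inj_on_le[of "\<lambda>x. x / x0"])
      show "inj_on (\<lambda>x. x / x0) {x \<in> ?G. ?f x = y}" using x0 by (auto intro!: inj_onI)
      show "(\<lambda>x. x / x0) ` {x \<in> ?G. ?f x = y} \<subseteq> {x. x ^ e = 1}"
        using x0 by (auto simp: power_divide)
    qed simp
  qed
  have "?f ` ?G \<subseteq> {y. y ^ k = 1}"
    using one by (auto simp: power_mult[symmetric])
  then have im: "card (?f ` ?G) \<le> k"
    by (rule order_trans[OF card_mono[OF card_roots_binomial_le(1)[OF kpos]]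
          card_roots_binomial_le(2)[OF kpos]])
  have "e * k = card ?G" using k by (simp add: card_Diff_singleton)
  also have "?G = (\<Union>y\<in>?f ` ?G. {x \<in> ?G. ?f x = y})" by auto
  also have "card \<dots> \<le> (\<Sum>y\<in>?f ` ?G. card {x \<in> ?G. ?f x = y})"
    by (rule card_UN_le) simp
  also have "\<dots> \<le> (\<Sum>y\<in>?f ` ?G. card {x::'a. x ^ e = 1})"
    by (rule sum_mono) (rule fib)
  also have "\<dots> \<le> k * card {x::'a. x ^ e = 1}"
    using im by simp
  finally show "e \<le> card {x::'a. x ^ e = 1}" using kpos by simp
qed

text \<open>A relation on the image is pulled back to one chosen index per vector. The second
  hypothesis also excludes equal vectors at different indices, so the criterion suits bases given as
  images of index sets.\<close>

lemma (in vector_space) independent_image_family: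
  assumes "finite J"
    and "\<And>c. (\<Sum>j\<in>J. c j *s w j) = 0 \<Longrightarrow> \<forall>j\<in>J. c j = 0"
  shows "independent (w ` J)"
proof
  assume "dependent (w ` J)"
  then obtain u v where u: "(\<Sum>v\<in>w ` J. u v *s v) = 0" and v: "v \<in> w ` J" "u v \<noteq> 0"
    using dependent_finite[of "w ` J"] assms(1) by auto
  define r where "r = inv_into J w"
  have r: "r x \<in> J" "w (r x) = x" if "x \<in> w ` J" for x
    using that by (auto simp: r_def inv_into_into f_inv_into_f)
  \<comment> \<open>Among the indices with the same vector only the chosen one carries the
    coefficient, so repeated vectors are not counted twice.\<close>
  define c where "c j = (if j = r (w j) then u (w j) else 0)" for j
  have "(\<Sum>j\<in>J. c j *s w j) = (\<Sum>j\<in>r ` w ` J. c j *s w j)"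
    by (rule sum.mono_neutral_right) (use assms(1) r in \<open>auto simp: c_def\<close>)
  also have "\<dots> = (\<Sum>v\<in>w ` J. c (r v) *s w (r v))"
    by (subst sum.reindex) (auto simp: inj_on_def r, metis r(2) imageI)
  also have "\<dots> = 0" using u by (simp add: c_def r)
  finally have "c (r v) = 0" using assms(2) r(1) v(1) by blast
  then show False using v r by (simp add: c_def)
qed

section \<open>Arithmetic of exponents with 0 kept apart from \<open>N - 1\<close>\<close>

lemma Z_rep_less: "N > 1 \<Longrightarrow> Z_rep N m < N"
  using mod_less_divisor[of "N - 1" "m - 1"] unfolding Z_rep_def by (auto simp del: mod_less_divisor)

lemma Z_rep_ident: "m < N \<Longrightarrow> Z_rep N m = m"
  by (cases m) (auto simp: Z_rep_def)

lemma Z_rep_0 [simp]: "Z_rep N 0 = 0"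
  by (simp add: Z_rep_def)

lemma Z_rep_eq_0_iff [simp]: "Z_rep N m = 0 \<longleftrightarrow> m = 0"
  by (simp add: Z_rep_def)

lemma cong_Z_rep: "[Z_rep N m = m] (mod (N - 1))"
proof (cases "m = 0")
  case False
  have "[(m - 1) mod (N - 1) + 1 = (m - 1) + 1] (mod (N - 1))"
    by (intro cong_add cong_refl) (simp add: cong_def)
  then show ?thesis using False by (simp add: Z_rep_def)
qed simp

text \<open>A representative is determined by the residue modulo \<open>N - 1\<close> together with
  being zero or not.\<close>

lemma Z_rep_cong:
  assumes "[m = n] (mod (N - 1))" and "m = 0 \<longleftrightarrow> n = 0"
  shows "Z_rep N m = Z_rep N n"
proof (cases "m = 0")
  case False
  then have "[(m - 1) + 1 = (n - 1) + 1] (mod (N - 1))" using assms by simp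
  then have "[m - 1 = n - 1] (mod (N - 1))" by (simp only: cong_add_rcancel_nat)
  then show ?thesis using False assms(2) by (simp add: Z_rep_def cong_def)
qed (use assms in simp)

lemma Z_rep_mult_Z_rep: "Z_rep N (k * Z_rep N m) = Z_rep N (k * m)"
  by (rule Z_rep_cong) (rule cong_scalar_left[OF cong_Z_rep], simp)

section \<open>The field extension and its Frobenius powers\<close>

locale projective_points =
  fixes \<iota> :: "'k::{field,finite} \<Rightarrow> 'a::{field,finite}" and p m q s N :: nat
  assumes prime_p: "prime p" and q_eq: "q = p ^ m"
    and card_K: "CARD('k) = q" and card_L: "CARD('a) = q ^ s"
    and embed: "field_embedding \<iota>"
    and N_gt_1: "N > 1" and N_dvd: "(N - 1) dvd (q ^ s - 1)" and p_dvd_N: "p dvd N"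
begin

sublocale V: vector_space "vscale \<iota> :: 'k \<Rightarrow> ('a \<times> 'a \<Rightarrow> 'a) \<Rightarrow> 'a \<times> 'a \<Rightarrow> 'a"
  by (rule vector_space_vscale[OF embed])

sublocale L: vector_space "vscale (\<lambda>x. x) :: 'a \<Rightarrow> ('a \<times> 'a \<Rightarrow> 'a) \<Rightarrow> 'a \<times> 'a \<Rightarrow> 'a"
  by (rule vector_space_vscale[OF field_embedding_id])

lemma iota_simps [simp]:
  "\<iota> 1 = 1" "\<iota> (x + y) = \<iota> x + \<iota> y" "\<iota> (x * y) = \<iota> x * \<iota> y" "\<iota> 0 = 0"
  "\<iota> (- x) = - \<iota> x" "\<iota> (x - y) = \<iota> x - \<iota> y" "\<iota> x = 0 \<longleftrightarrow> x = 0"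
  "\<iota> (x ^ n) = \<iota> x ^ n"
proof -
  show one: "\<iota> 1 = 1" and add: "\<iota> (x + y) = \<iota> x + \<iota> y" and mult: "\<iota> (x * y) = \<iota> x * \<iota> y" for x y
    using embed by (auto simp: field_embedding_def)
  show z: "\<iota> 0 = 0" using add[of 0 0] by (metis add.right_neutral add_left_cancel)
  show m: "\<iota> (- x) = - \<iota> x" for x using add[of x "- x"] z by (simp add: eq_neg_iff_add_eq_0 add.commute)
  show "\<iota> (x - y) = \<iota> x - \<iota> y" using add[of x "- y"] m[of y] by simp
  show "\<iota> x = 0 \<longleftrightarrow> x = 0"
    using mult[of x "inverse x"] one z by (cases "x = 0") auto
  show "\<iota> (x ^ n) = \<iota> x ^ n" by (induction n) (auto simp: one mult)
qed

lemma inj_iota: "inj \<iota>"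
  by (rule injI) (metis iota_simps(6,7) right_minus_eq)

lemma q_gt_1: "q > 1"
  using card_mono[of UNIV "{0, 1::'k}"] card_K by simp

lemma s_pos: "s > 0"
  using card_mono[of UNIV "{0, 1::'a}"] card_L by (cases s) auto

text \<open>Translation by 1 permutes the field; summing all elements shows that the order of the
  field, a power of \<open>p\<close>, is zero in it.\<close>

lemma CHAR_eq: "CHAR('a) = p"
proof -
  have "(\<Sum>x\<in>UNIV. x + 1) = (\<Sum>x\<in>UNIV. x :: 'a)"
    by (rule sum.reindex_bij_witness[of _ "\<lambda>x. x - 1" "\<lambda>x. x + 1"]) auto
  then have "of_nat (CARD('a)) = (0 :: 'a)" by (simp add: sum.distrib)
  then have "CHAR('a) dvd p ^ (m * s)"
    unfolding of_nat_eq_0_iff_char_dvd card_L q_eq power_mult .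
  moreover have "prime CHAR('a)"
    using prime_CHAR_semidom[where ?'a = 'a] finite_imp_CHAR_pos[where ?'a = 'a] by simp
  ultimately show ?thesis
    using prime_dvd_power primes_dvd_imp_eq prime_p by blast
qed

lemma of_nat_N: "of_nat N = (0 :: 'a)"
  using p_dvd_N by (simp add: of_nat_eq_0_iff_char_dvd CHAR_eq)

lemma frobenius_add: "(x + y :: 'a) ^ q ^ i = x ^ q ^ i + y ^ q ^ i"
  by (rule freshmans_dream'[of _ "m * i"]) (auto simp: CHAR_eq prime_p q_eq power_mult)

lemma frobenius_sum: "sum f A ^ q ^ i = (\<Sum>x\<in>A. f x ^ q ^ i :: 'a)"
  by (rule freshmans_dream_sum'[of _ "m * i"]) (auto simp: CHAR_eq prime_p q_eq power_mult)

lemma frobenius_minus: "(- x :: 'a) ^ q ^ i = - (x ^ q ^ i)"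
proof -
  have "q ^ i \<noteq> 0" using q_gt_1 by simp
  then have "(- x) ^ q ^ i + x ^ q ^ i = 0"
    using frobenius_add[of "- x" x i] by (metis add.left_inverse power_0_left)
  then show ?thesis by (simp add: eq_neg_iff_add_eq_0)
qed

text \<open>The image consists of \<open>q\<close> roots of \<open>x ^ q - x\<close>, which has at
  most \<open>q\<close> of them.\<close>

lemma range_iota: "range \<iota> = {x. x ^ q = x}"
proof (rule card_seteq)
  show "range \<iota> \<subseteq> {x. x ^ q = x}"
    using power_card_UNIV_eq_same[where ?'a = 'k] by (auto simp: card_K simp flip: iota_simps(8))
  show "card {x::'a. x ^ q = x} \<le> card (range \<iota>)"
    using card_fixed_power_le(2)[OF q_gt_1, where ?'a = 'a] by (simp add: card_image inj_iota card_K)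
qed simp

lemma iota_power [simp]: "\<iota> c ^ q ^ i = \<iota> c"
proof (induction i)
  case (Suc i)
  have "\<iota> c \<in> {x. x ^ q = x}" using range_iota by blast
  then show ?case using Suc by (simp add: power_mult)
qed simp

text \<open>As \<open>n dvd s\<close>, the number \<open>q ^ n - 1\<close> divides the number
  \<open>q ^ s - 1\<close> of units, so all roots of unity of that order are present; zero is the
  remaining element.\<close>

lemma card_subfield_of_order:
  assumes "n > 0" "n dvd s"
  shows "card (subfield_of_order (q ^ n) :: 'a set) = q ^ n"
proof -
  have gt: "q ^ n > 1" using q_gt_1 assms by (intro one_less_power)
  obtain k where k: "s = n * k" using assms by blast
  have "(q ^ n - 1) dvd (q ^ n) ^ k - 1"
  proof -
    have "int (q ^ n) - 1 dvd int (q ^ n) ^ k - 1"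
      unfolding power_diff_1_eq[of "int (q ^ n)" k] by simp
    then have "int (q ^ n - 1) dvd int ((q ^ n) ^ k - 1)"
      using gt by (simp add: of_nat_diff)
    then show ?thesis by (simp only: int_dvd_int_iff)
  qed
  then have "card {x::'a. x ^ (q ^ n - 1) = 1} = q ^ n - 1"
    using gt by (intro card_roots_of_unity_finite_field) (auto simp: card_L k power_mult)
  moreover have "subfield_of_order (q ^ n) = insert 0 {x::'a. x ^ (q ^ n - 1) = 1}"
  proof -
    have "x ^ q ^ n = x * x ^ (q ^ n - 1)" for x :: 'a
      using gt by (metis One_nat_def Suc_pred gr0I less_zeroE power_Suc)
    then show ?thesis using gt by (auto simp: subfield_of_order_def)
  qed
  moreover have "(0::'a) ^ (q ^ n - 1) \<noteq> 1" using gt by (simp add: power_0_left)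
  ultimately show ?thesis using gt by simp
qed

section \<open>Power sums over the affine points\<close>

lemma Y_pts_eq: "Y_pts N = insert 0 {x::'a. x ^ (N - 1) = 1}"
proof -
  have "x ^ N = x * x ^ (N - 1)" for x :: 'a
    using N_gt_1 by (metis One_nat_def Suc_pred gr0I less_zeroE power_Suc)
  then show ?thesis by (auto simp: Y_pts_def)
qed

lemma card_units_Y: "card {x::'a. x ^ (N - 1) = 1} = N - 1"
  using N_gt_1 N_dvd by (intro card_roots_of_unity_finite_field) (auto simp: card_L)

lemma card_Y_pts: "card (Y_pts N :: 'a set) = N"
  using N_gt_1 card_units_Y by (simp add: Y_pts_eq power_0_left)

text \<open>Apart from 0 the points form a group of \<open>N - 1\<close> roots of unity: a trivial
  character sums to \<open>N - 1 = - 1\<close>, any other to 0. For \<open>k = 0\<close> the point 0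
  counts too, since \<open>0 ^ 0 = 1\<close>, and the sum is \<open>N = 0\<close>.\<close>

lemma sum_Y_pts_power:
  "(\<Sum>z\<in>Y_pts N. z ^ k) = (if k > 0 \<and> (N - 1) dvd k then - 1 else (0 :: 'a))"
proof (cases "k = 0")
  case True
  then show ?thesis by (simp add: card_Y_pts of_nat_N)
next
  case k: False
  let ?U = "{x::'a. x ^ (N - 1) = 1}"
  have U: "(\<Sum>z\<in>Y_pts N. z ^ k) = (\<Sum>z\<in>?U. z ^ k)"
    using k N_gt_1 by (simp add: Y_pts_eq power_0_left)
  show ?thesis
  proof (cases "(N - 1) dvd k")
    case True
    then have "(\<Sum>z\<in>?U. z ^ k) = (\<Sum>z\<in>?U. 1)"
      by (intro sum.cong refl) (auto simp: power_mult elim!: dvdE)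
    also have "\<dots> = - 1"
      using N_gt_1 of_nat_N by (simp only: sum_constant card_units_Y) (simp add: of_nat_diff)
    finally show ?thesis using k True U by simp
  next
    case False
    define r where "r = k mod (N - 1)"
    have r: "r > 0" "r < N - 1" using False N_gt_1 by (auto simp: r_def dvd_eq_mod_eq_0)
    have pow: "z ^ k = z ^ r" if "z \<in> ?U" for z
    proof -
      have "z ^ k = z ^ ((N - 1) * (k div (N - 1)) + r)" by (simp add: r_def)
      also have "\<dots> = z ^ r" using that by (simp only: power_add power_mult) simp
      finally show ?thesis .
    qed
    \<comment> \<open>Since \<open>r < N - 1\<close>, the equation \<open>x ^ r = 1\<close> has
      fewer roots than \<open>?U\<close> has elements. Substituting \<open>y * z\<close> for a
      \<open>y\<close> that is not a root multiplies the sum by \<open>y ^ r\<close>.\<close>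
    have "\<not> ?U \<subseteq> {x. x ^ r = 1}"
      using card_mono[OF card_roots_binomial_le(1)[OF r(1), of "1::'a"], of ?U]
        card_roots_binomial_le(2)[OF r(1), of "1::'a"] r card_units_Y by auto
    then obtain y where y: "y \<in> ?U" "y ^ r \<noteq> 1" by blast
    then have "y \<noteq> 0" using N_gt_1 by (auto simp: power_0_left)
    then have "(\<Sum>z\<in>?U. z ^ k) = (\<Sum>z\<in>?U. (y * z) ^ k)"
      by (intro sum.reindex_bij_witness[of _ "\<lambda>z. y * z" "\<lambda>z. z / y"])
        (use y in \<open>auto simp: power_mult_distrib power_divide\<close>)
    also have "\<dots> = y ^ r * (\<Sum>z\<in>?U. z ^ k)"
      by (simp add: power_mult_distrib sum_distrib_left pow[OF y(1)])
    finally have "(\<Sum>z\<in>?U. z ^ k) = 0" using y(2) by simp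
    then show ?thesis using U False by simp
  qed
qed

text \<open>At nonzero points \<open>z ^ (N - 1) = 1\<close>; at \<open>z = 0\<close> only the
  exponent 0 gives 1, which is why \<open>Z_rep\<close> keeps 0 apart.\<close>

lemma power_Z_rep: "z \<in> Y_pts N \<Longrightarrow> z ^ Z_rep N n = (z :: 'a) ^ n"
proof (cases "z = 0 \<or> n = 0")
  case False
  assume "z \<in> Y_pts N"
  then have z: "z ^ (N - 1) = 1" using False by (simp add: Y_pts_eq)
  have "n = (n - 1) mod (N - 1) + 1 + (N - 1) * ((n - 1) div (N - 1))" using False
    by (metis One_nat_def Suc_pred' add.assoc add.commute mod_mult_div_eq neq0_conv plus_1_eq_Suc)
  then have "z ^ n = z ^ ((n - 1) mod (N - 1) + 1) * (z ^ (N - 1)) ^ ((n - 1) div (N - 1))"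
    by (metis power_add power_mult)
  then show ?thesis using z False by (simp add: Z_rep_def)
qed (auto simp: power_0_left)

section \<open>Cyclotomic sets as orbits\<close>

text \<open>On the affine points, raising \<open>z ^ a\<close> to the power \<open>q ^ i\<close>
  gives \<open>z ^ orb i a\<close>.\<close>

definition orb :: "nat \<Rightarrow> nat \<Rightarrow> nat" where
  "orb i a = Z_rep N (q ^ i * a)"

lemma cyc_eq_range_orb: "cyc q N a = range (\<lambda>i. orb i a)"
  by (simp add: cyc_def orb_def)

lemma orb_less [simp]: "orb i a < N"
  using N_gt_1 unfolding orb_def by (rule Z_rep_less)

lemma orb_0: "a < N \<Longrightarrow> orb 0 a = a"
  by (simp add: orb_def Z_rep_ident)

lemma orb_eq_0_iff [simp]: "orb i a = 0 \<longleftrightarrow> a = 0"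
  using q_gt_1 by (simp add: orb_def)

lemma orb_orb [simp]: "orb i (orb j a) = orb (i + j) a"
  by (simp add: orb_def Z_rep_mult_Z_rep power_add mult.assoc)

lemma orb_mult_s:
  assumes "a < N"
  shows "orb (s * k) a = a"
proof -
  have "[q ^ s = 1] (mod (N - 1))"
    using N_dvd q_gt_1 by (simp add: cong_altdef_nat)
  then have "[(q ^ s) ^ k * a = 1 ^ k * a] (mod (N - 1))"
    by (intro cong_mult cong_pow cong_refl)
  then have "Z_rep N (q ^ (s * k) * a) = Z_rep N a"
    using q_gt_1 by (intro Z_rep_cong) (auto simp: power_mult)
  then show ?thesis using assms by (simp add: orb_def Z_rep_ident)
qed

lemma orb_inverse:
  assumes "a < N"
  obtains k where "orb k (orb i a) = a"
proof
  \<comment> \<open>Every orbit closes after \<open>s\<close> steps, so \<open>i * (s - 1)\<close>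
    further steps complete \<open>i\<close> to a multiple of \<open>s\<close>.\<close>
  have "i * (s - 1) + i = s * i"
    using s_pos by (cases s) auto
  then show "orb (i * (s - 1)) (orb i a) = a"
    using assms by (simp only: orb_orb orb_mult_s)
qed

lemma cyc_subset: "cyc q N a \<subseteq> {..<N}"
  by (auto simp: cyc_eq_range_orb)

lemma finite_cyc [simp]: "finite (cyc q N a)"
  by (rule finite_subset[OF cyc_subset]) simp

lemma self_in_cyc [simp]: "a < N \<Longrightarrow> a \<in> cyc q N a"
  unfolding cyc_eq_range_orb by (metis orb_0 rangeI)

lemma cyc_eqI:
  assumes "a < N" "x \<in> cyc q N a"
  shows "cyc q N x = cyc q N a"
proof -
  obtain i where i: "x = orb i a" using assms by (auto simp: cyc_eq_range_orb)
  obtain k where k: "orb k x = a" using orb_inverse assms(1) i by metis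
  have "cyc q N x \<subseteq> cyc q N a" unfolding i by (auto simp: cyc_eq_range_orb)
  moreover have "cyc q N (orb k x) \<subseteq> cyc q N x" by (auto simp: cyc_eq_range_orb)
  ultimately show ?thesis using k by simp
qed

lemma orb_in_cyc [simp]: "orb i a \<in> cyc q N a"
  by (auto simp: cyc_eq_range_orb)

text \<open>All four claims follow from the first return time \<open>n\<close> of \<open>a\<close>:
  the orbit has period \<open>n\<close>, its first \<open>n\<close> terms are distinct, and every
  return time is a multiple of \<open>n\<close>.\<close>

lemma
  assumes "a < N"
  shows cyc_card_pos: "cyc_card q N a > 0"
    and cyc_card_dvd: "cyc_card q N a dvd s"
    and orb_cyc_card: "orb (cyc_card q N a) a = a"
    and bij_betw_orb: "bij_betw (\<lambda>i. orb i a) {..<cyc_card q N a} (cyc q N a)"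
proof -
  define n where "n = (LEAST n. n > 0 \<and> orb n a = a)"
  have n: "n > 0 \<and> orb n a = a"
    unfolding n_def by (rule LeastI[of _ s]) (use s_pos orb_mult_s[OF assms, of 1] in auto)
  have least: "k = 0" if "k < n" "orb k a = a" for k
    using not_less_Least[of k "\<lambda>n. n > 0 \<and> orb n a = a"] that n_def by auto
  have per: "orb (i + n * j) a = orb i a" for i j
  proof (induction j)
    case (Suc j)
    have "orb (i + n * Suc j) a = orb (i + n * j) (orb n a)" by (simp add: algebra_simps)
    then show ?case using n Suc by simp
  qed simp
  have md: "orb (i mod n) a = orb i a" for i
    using per[of "i mod n" "i div n"] by simp
  have inj: "inj_on (\<lambda>i. orb i a) {..<n}"
  proof (rule linorder_inj_onI)
    fix i j assume ij: "i < j" "i \<in> {..<n}" "j \<in> {..<n}"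
    show "orb i a \<noteq> orb j a"
    proof
      assume "orb i a = orb j a"
      \<comment> \<open>Moving on by \<open>n - j\<close> steps takes the right side to
        \<open>a\<close>, so \<open>n - j + i\<close> is a return time, and \<open>i < j < n\<close>
        puts it strictly between 0 and \<open>n\<close>.\<close>
      then have "orb (n - j) (orb i a) = orb (n - j) (orb j a)" by simp
      then have "orb (n - j + i) a = a" using ij n by simp
      moreover have "n - j + i < n" using ij by auto
      ultimately have "n - j + i = 0" by (intro least)
      then show False using ij by auto
    qed
  qed auto
  have im: "(\<lambda>i. orb i a) ` {..<n} = cyc q N a"
    unfolding cyc_eq_range_orb using md n by (auto simp: image_iff) (metis mod_less_divisor lessThan_iff)
  have card: "cyc_card q N a = n"
    using card_image[OF inj] im by (simp add: cyc_card_def)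
  show "cyc_card q N a > 0" "orb (cyc_card q N a) a = a" using n card by auto
  show "bij_betw (\<lambda>i. orb i a) {..<cyc_card q N a} (cyc q N a)"
    using inj im card by (simp add: bij_betw_def)
  \<comment> \<open>The remainder of the return time \<open>s\<close> is a return time below the
    least positive one.\<close>
  have "s mod n = 0"
    by (rule least) (use n md[of s] orb_mult_s[OF assms, of 1] in auto)
  then show "cyc_card q N a dvd s" using card by auto
qed

text \<open>Modulo \<open>N - 1\<close> the reflection is negation, which commutes with
  multiplication by \<open>q ^ i\<close>. The representative also depends on being zero; the
  reflection is zero only at \<open>N - 1\<close>, a fixed point of every
  \<open>orb i\<close>.\<close>

lemma orb_reflect:
  assumes "j < N"
  shows "orb i (N - 1 - j) = N - 1 - orb i j"
proof -
  have top: "orb i (N - 1) = N - 1" for i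
  proof -
    have "Z_rep N (q ^ i * (N - 1)) = Z_rep N (N - 1)"
      using q_gt_1 N_gt_1 by (intro Z_rep_cong) (auto simp: cong_def)
    then show ?thesis using N_gt_1 by (simp add: orb_def Z_rep_ident)
  qed
  have "N - 1 - j = 0 \<longleftrightarrow> N - 1 - orb i j = 0"
  proof
    assume "N - 1 - j = 0"
    then have "j = N - 1" using assms by simp
    then show "N - 1 - orb i j = 0" by (simp only: top)
  next
    assume "N - 1 - orb i j = 0"
    then have "orb i j = orb i (N - 1)" using orb_less[of i j] by (simp only: top)
    moreover obtain k where "orb k (orb i j) = j" using orb_inverse[OF assms] .
    moreover have "orb k (orb i (N - 1)) = N - 1"
      using top by (simp only: top)
    ultimately show "N - 1 - j = 0" by simp
  qed
  moreover have "[q ^ i * (N - 1 - j) = N - 1 - orb i j] (mod (N - 1))"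
  proof -
    have "[q ^ i * (N - 1 - j) + q ^ i * j = 0] (mod (N - 1))"
      using assms by (simp add: cong_0_iff flip: add_mult_distrib2)
    moreover have "[N - 1 - orb i j + orb i j = 0] (mod (N - 1))"
    proof -
      have "N - 1 - orb i j + orb i j = N - 1" using orb_less[of i j] by linarith
      then show ?thesis by (simp only: cong_0_iff dvd_refl)
    qed
    moreover have "[N - 1 - orb i j + orb i j = N - 1 - orb i j + q ^ i * j] (mod (N - 1))"
      unfolding orb_def by (intro cong_add cong_refl cong_Z_rep)
    ultimately have "[q ^ i * (N - 1 - j) + q ^ i * j = N - 1 - orb i j + q ^ i * j] (mod (N - 1))"
      by (meson cong_sym cong_trans)
    then show ?thesis by (simp only: cong_add_rcancel_nat)
  qed
  ultimately have "Z_rep N (q ^ i * (N - 1 - j)) = Z_rep N (N - 1 - orb i j)"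
    using q_gt_1 by (intro Z_rep_cong) auto
  then show ?thesis using N_gt_1 by (simp add: orb_def Z_rep_ident)
qed

lemma cyc_reflect:
  assumes "j < N"
  shows "cyc q N (N - 1 - j) = (\<lambda>x. N - 1 - x) ` cyc q N j"
  unfolding cyc_eq_range_orb orb_reflect[OF assms] image_image ..

lemma cyc_card_reflect:
  assumes "j < N"
  shows "cyc_card q N (N - 1 - j) = cyc_card q N j"
  unfolding cyc_card_def cyc_reflect[OF assms]
proof (rule card_image, rule inj_onI)
  fix x y assume "x \<in> cyc q N j" "y \<in> cyc q N j" "N - 1 - x = N - 1 - y"
  moreover from this have "x < N" "y < N" using cyc_subset by blast+
  ultimately show "x = y" by linarith
qed

lemma cyc_0: "cyc q N 0 = {0}"
  by (auto simp: cyc_eq_range_orb)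

lemma cyc_top: "cyc q N (N - 1) = {N - 1}"
  using cyc_reflect[of 0] N_gt_1 cyc_0 by simp

section \<open>Interpolation on the affine points\<close>

text \<open>The coefficients of the polynomial of degree less than \<open>N\<close> that interpolates
  \<open>z \<mapsto> v (1, z)\<close> on \<open>Y_pts N\<close>. As \<open>0 ^ 0 = 1\<close>, the point \<open>z = 0\<close> contributes to the
  sum exactly when \<open>j = N - 1\<close>.\<close>

definition cf :: "('a \<times> 'a \<Rightarrow> 'a) \<Rightarrow> nat \<Rightarrow> 'a" where
  "cf v j = (if j = 0 then v (1, 0) else - (\<Sum>z\<in>Y_pts N. v (1, z) * z ^ (N - 1 - j)))"

lemma cf_0 [simp]: "cf 0 j = 0"
  by (simp add: cf_def)

lemma cf_add: "cf (v + w) j = cf v j + cf w j"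
  by (simp add: cf_def algebra_simps sum.distrib)

lemma cf_vscale: "cf (vscale \<kappa> c v) j = \<kappa> c * cf v j"
  by (simp add: cf_def vscale_def sum_distrib_left mult.assoc)

lemma cf_sum: "cf (\<Sum>i\<in>A. w i) j = (\<Sum>i\<in>A. cf (w i) j)"
  by (induction A rule: infinite_finite_induct) (simp_all only: sum.infinite sum.empty sum.insert cf_add cf_0 not_False_eq_True)

lemma zero_in_Y [simp]: "0 \<in> Y_pts N" and one_in_Y [simp]: "1 \<in> Y_pts N"
  using N_gt_1 by (auto simp: Y_pts_def)

text \<open>Uniqueness of interpolation: multiplying by \<open>z ^ (N - 1 - j)\<close> and summing
  over the points leaves only the term \<open>i = j\<close>, by the power sums.\<close>

lemma cf_eqI:
  assumes v: "\<And>z. z \<in> Y_pts N \<Longrightarrow> v (1, z) = (\<Sum>i<N. a i * z ^ i)" and "j < N"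
  shows "cf v j = a j"
proof (cases "j = 0")
  case True
  then show ?thesis
    using v[of 0] N_gt_1 by (simp add: cf_def power_0_left if_distrib cong: if_cong)
next
  case False
  have "(\<Sum>z\<in>Y_pts N. v (1, z) * z ^ (N - 1 - j)) =
      (\<Sum>z\<in>Y_pts N. \<Sum>i<N. a i * z ^ (i + (N - 1 - j)))"
    by (simp add: v sum_distrib_right power_add mult.assoc)
  also have "\<dots> = (\<Sum>i<N. a i * (\<Sum>z\<in>Y_pts N. z ^ (i + (N - 1 - j))))"
    by (subst sum.swap) (simp add: sum_distrib_left)
  also have "\<dots> = (\<Sum>i<N. if i = j then - a i else 0)"
  proof (intro sum.cong refl)
    fix i assume i: "i \<in> {..<N}"
    have "i + (N - 1 - j) > 0 \<and> (N - 1) dvd (i + (N - 1 - j)) \<longleftrightarrow> i = j"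
    proof
      assume A: "i + (N - 1 - j) > 0 \<and> (N - 1) dvd (i + (N - 1 - j))"
      then obtain k where k: "i + (N - 1 - j) = (N - 1) * k" by auto
      \<comment> \<open>This needs \<open>j > 0\<close>. For \<open>j = 0\<close> the term
        \<open>i = N - 1\<close> would survive as well, which is why \<open>cf v 0\<close> is the
        value at 0.\<close>
      have "i + (N - 1 - j) < (N - 1) * 2"
        using i False assms(2) unfolding lessThan_iff by linarith
      then have "k < 2" unfolding k by (simp only: mult_less_cancel1)
      moreover have "k \<noteq> 0" using k A by auto
      ultimately have "k = 1" by simp
      then show "i = j" using k i assms(2) by simp
    qed (use assms(2) N_gt_1 in auto)
    then show "a i * (\<Sum>z\<in>Y_pts N. z ^ (i + (N - 1 - j))) = (if i = j then - a i else 0)"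
      by (simp only: sum_Y_pts_power if_distrib) simp
  qed
  also have "\<dots> = - a j" using assms(2) by simp
  finally show ?thesis using False by (simp add: cf_def)
qed

text \<open>Lagrange interpolation: for \<open>y \<noteq> 0\<close> the kernel of the double sum is
  1 at \<open>z = 0\<close>, -1 at \<open>z = y\<close> and 0 at the other points.\<close>

lemma eval_cf:
  assumes "y \<in> Y_pts N"
  shows "v (1, y) = (\<Sum>j<N. cf v j * y ^ j)"
proof -
  have split: "(\<Sum>j<N. cf v j * y ^ j) =
      v (1, 0) - (\<Sum>z\<in>Y_pts N. v (1, z) * (\<Sum>j\<in>{1..<N}. z ^ (N - 1 - j) * y ^ j))"
  proof -
    have "(\<Sum>j<N. cf v j * y ^ j) = cf v 0 + (\<Sum>j\<in>{1..<N}. cf v j * y ^ j)"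
      using N_gt_1 by (simp add: lessThan_atLeast0 sum.atLeast_Suc_lessThan)
    also have "(\<Sum>j\<in>{1..<N}. cf v j * y ^ j) =
        - (\<Sum>j\<in>{1..<N}. \<Sum>z\<in>Y_pts N. v (1, z) * (z ^ (N - 1 - j) * y ^ j))"
      by (simp add: cf_def sum_distrib_right sum_negf mult.assoc)
    also have "\<dots> = - (\<Sum>z\<in>Y_pts N. v (1, z) * (\<Sum>j\<in>{1..<N}. z ^ (N - 1 - j) * y ^ j))"
      by (subst sum.swap) (simp add: sum_distrib_left)
    finally show ?thesis by (simp add: cf_def)
  qed
  have inner: "(\<Sum>j\<in>{1..<N}. z ^ (N - 1 - j) * y ^ j) =
      (if y = 0 then 0 else if z = 0 then 1 else if z = y then - 1 else 0)"
    if z: "z \<in> Y_pts N" for z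
  proof -
    consider "y = 0" | "y \<noteq> 0" "z = 0" | "y \<noteq> 0" "z \<noteq> 0" by blast
    then show ?thesis
    proof cases
      case 2
      have "(\<Sum>j\<in>{1..<N}. z ^ (N - 1 - j) * y ^ j) = (\<Sum>j\<in>{N - 1}. y ^ j)"
        by (rule sum.mono_neutral_cong_right) (use 2 N_gt_1 in \<open>auto simp: power_0_left\<close>)
      then show ?thesis using 2 assms by (simp add: Y_pts_eq)
    next
      case 3
      have y: "y ^ (N - 1) = 1" and z: "z ^ (N - 1) = 1" using 3 assms z by (auto simp: Y_pts_eq)
      have "(\<Sum>j\<in>{1..<N}. z ^ (N - 1 - j) * y ^ j) = (\<Sum>j\<in>{1..<N}. (y / z) ^ j)"
        using 3 z by (intro sum.cong refl) (auto simp: power_diff power_divide)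
      \<comment> \<open>A geometric sum in the \<open>(N - 1)\<close>-th root of unity
        \<open>y / z\<close>: it vanishes unless \<open>y = z\<close>, when it is
        \<open>N - 1 = - 1\<close>.\<close>
      also have "\<dots> = (y / z) * (\<Sum>j<N - 1. (y / z) ^ j)"
        using N_gt_1
        by (simp add: sum_distrib_left lessThan_atLeast0 sum.shift_bounds_Suc_ivl[symmetric]
            flip: power_Suc)
      also have "\<dots> = (if z = y then - 1 else 0)"
      proof (cases "z = y")
        case True
        then show ?thesis using 3 of_nat_N N_gt_1 by (simp add: of_nat_diff)
      next
        case False
        have "(y / z) ^ (N - 1) - 1 = (y / z - 1) * (\<Sum>j<N - 1. (y / z) ^ j)"
          by (rule power_diff_1_eq)
        then show ?thesis using False y z 3 by (simp add: power_divide)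
      qed
      finally show ?thesis using 3 by simp
    qed simp
  qed
  show ?thesis
  proof (cases "y = 0")
    case True
    then show ?thesis unfolding split using inner by simp
  next
    case False
    have "(\<Sum>z\<in>Y_pts N. v (1, z) * (\<Sum>j\<in>{1..<N}. z ^ (N - 1 - j) * y ^ j)) =
        (\<Sum>z\<in>Y_pts N. (if z = 0 then v (1, z) else 0) - (if z = y then v (1, z) else 0))"
      by (intro sum.cong refl) (use inner False in auto)
    also have "\<dots> = v (1, 0) - v (1, y)"
      using assms by (simp add: sum_subtractf)
    finally show ?thesis unfolding split by simp
  qed
qed

section \<open>Pairing of vectors and conjugacy of their coefficients\<close>

lemma X_pts_cases:
  assumes "P \<in> X_pts N"
  obtains z where "z \<in> Y_pts N" "P = (1, z)" | "P = (0, 1)"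
  using assms by (auto simp: X_pts_def)

lemma affine_in_X [simp]: "(1, z) \<in> X_pts N \<longleftrightarrow> z \<in> Y_pts N"
  and inf_in_X [simp]: "(0, 1) \<in> X_pts N"
  by (auto simp: X_pts_def)

lemma code_vector_eqI:
  assumes "\<And>P. P \<notin> X_pts N \<Longrightarrow> v P = w P" and "\<And>j. j < N \<Longrightarrow> cf v j = cf w j"
    and "v (0, 1) = w (0, 1)"
  shows "v = w"
proof
  fix P
  show "v P = w P"
  proof (cases "P \<in> X_pts N")
    case True
    then show ?thesis
    proof (cases rule: X_pts_cases)
      case (1 z)
      then show ?thesis using assms(2) by (simp add: eval_cf[of z])
    qed (use assms(3) in simp)
  qed (use assms(1) in simp)
qed

lemma cf_cong: "(\<And>z. z \<in> Y_pts N \<Longrightarrow> v (1, z) = w (1, z)) \<Longrightarrow> cf v j = cf w j"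
  by (simp add: cf_def)

lemma sum_X_pts: "(\<Sum>P\<in>X_pts N. f P) = f (0, 1) + (\<Sum>z\<in>Y_pts N. f (1, z :: 'a) :: 'a)"
proof -
  have "X_pts N = insert (0, 1) (Pair 1 ` (Y_pts N :: 'a set))"
    by (auto simp: X_pts_def)
  then show ?thesis
    by (simp add: image_iff sum.reindex inj_on_def)
qed

text \<open>Expanding \<open>w\<close> reduces this to the sums of \<open>v (1, z) * z ^ j\<close>,
  which are \<open>- cf v (N - 1 - j)\<close> by definition for \<open>j < N - 1\<close>. At
  \<open>j = N - 1\<close> the power is the indicator of \<open>z \<noteq> 0\<close>, whence the
  extra term.\<close>

lemma pairing:
  "(\<Sum>z\<in>Y_pts N. v (1, z) * w (1, z)) =
    - (\<Sum>j<N. cf v (N - 1 - j) * cf w j) - cf v (N - 1) * cf w (N - 1)"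
proof -
  have S: "(\<Sum>z\<in>Y_pts N. v (1, z) * z ^ j) = - cf v (N - 1 - j) - (if j = N - 1 then cf v (N - 1) else 0)"
    if j: "j < N" for j
  proof (cases "j = N - 1")
    case True
    have "(\<Sum>z\<in>Y_pts N. v (1, z) * z ^ j) = (\<Sum>z\<in>Y_pts N - {0}. v (1, z) * z ^ j)"
      by (rule sum.mono_neutral_right) (use True N_gt_1 in \<open>auto simp: power_0_left\<close>)
    also have "\<dots> = (\<Sum>z\<in>Y_pts N - {0}. v (1, z))"
      using True by (intro sum.cong refl) (auto simp: Y_pts_eq)
    also have "\<dots> = (\<Sum>z\<in>Y_pts N. v (1, z)) - v (1, 0)"
      by (simp add: sum_diff1)
    finally show ?thesis using True N_gt_1 by (simp add: cf_def)
  next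
    case False
    then show ?thesis using j by (simp add: cf_def)
  qed
  have "(\<Sum>z\<in>Y_pts N. v (1, z) * w (1, z)) =
      (\<Sum>z\<in>Y_pts N. \<Sum>j<N. cf w j * (v (1, z) * z ^ j))"
    by (intro sum.cong refl) (simp add: eval_cf[of _ w] sum_distrib_left mult_ac)
  also have "\<dots> = (\<Sum>j<N. cf w j * (\<Sum>z\<in>Y_pts N. v (1, z) * z ^ j))"
    by (subst sum.swap) (simp add: sum_distrib_left)
  also have "\<dots> = (\<Sum>j<N. - (cf v (N - 1 - j) * cf w j) - (if j = N - 1 then cf v (N - 1) * cf w j else 0))"
  proof (intro sum.cong refl, goal_cases)
    case (1 j)
    then have "j < N" by simp
    show ?case unfolding S[OF \<open>j < N\<close>] by (simp add: algebra_simps)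
  qed
  also have "\<dots> = - (\<Sum>j<N. cf v (N - 1 - j) * cf w j) - cf v (N - 1) * cf w (N - 1)"
    using N_gt_1 by (simp add: sum_subtractf sum_negf)
  finally show ?thesis .
qed

text \<open>The values of \<open>v\<close> are fixed by the Frobenius power, so it acts only on the
  monomials in the defining sum, moving their exponents as in \<open>orb_reflect\<close>.\<close>

lemma cf_orb:
  assumes v: "v \<in> subfield_vectors \<iota> N" and j: "j < N"
  shows "cf v (orb i j) = cf v j ^ q ^ i"
proof -
  have fixed: "v (1, z) ^ q ^ i = v (1, z)" if "z \<in> Y_pts N" for z
  proof -
    have "v (1, z) \<in> range \<iota>" using v that by (auto simp: subfield_vectors_def)
    then show ?thesis by auto
  qed
  show ?thesis
  proof (cases "j = 0")
    case True
    then show ?thesis by (simp add: cf_def fixed)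
  next
    case False
    have "(z ^ (N - 1 - j)) ^ q ^ i = z ^ (N - 1 - orb i j)" if "z \<in> Y_pts N" for z :: 'a
    proof -
      have "(z ^ (N - 1 - j)) ^ q ^ i = z ^ (q ^ i * (N - 1 - j))"
        by (simp add: mult.commute flip: power_mult)
      also have "\<dots> = z ^ orb i (N - 1 - j)" using that by (simp add: orb_def power_Z_rep)
      finally show ?thesis using orb_reflect[OF j] by simp
    qed
    then show ?thesis using False
      by (simp add: cf_def frobenius_minus frobenius_sum power_mult_distrib fixed)
  qed
qed

lemma cf_eq_0_iff_cyc:
  assumes "v \<in> subfield_vectors \<iota> N" "j < N" "x \<in> cyc q N j"
  shows "cf v x = 0 \<longleftrightarrow> cf v j = 0"
  using assms cf_orb[OF assms(1,2)] q_gt_1 by (auto simp: cyc_eq_range_orb)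

lemma sum_over_cyc:
  assumes a: "a < N" and f: "\<And>j. j < N \<Longrightarrow> j \<notin> cyc q N a \<Longrightarrow> f j = (0::'a)"
  shows "(\<Sum>j<N. f j) = (\<Sum>i<cyc_card q N a. f (orb i a))"
proof -
  have "(\<Sum>j<N. f j) = (\<Sum>j\<in>cyc q N a. f j)"
    by (rule sum.mono_neutral_right) (use cyc_subset f in auto)
  also have "\<dots> = (\<Sum>i<cyc_card q N a. f (orb i a))"
    by (rule sum.reindex_bij_betw[OF bij_betw_orb[OF a], symmetric])
  finally show ?thesis .
qed

section \<open>Trace vectors and their coefficients\<close>

lemma eval2_power [simp]: "eval2 (f ^ n) P = eval2 f P ^ n"
  by (induction n) (auto simp: eval2_def)

lemma eval2_sum: "eval2 (\<Sum>i\<in>A. f i) P = (\<Sum>i\<in>A. eval2 (f i) P)"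
  by (induction A rule: infinite_finite_induct) (auto simp: eval2_def)

lemma eval2_cyc_trace: "eval2 (cyc_trace q N a f) P = cyc_trace q N a (eval2 f P)"
  by (simp add: cyc_trace_def eval2_sum)

text \<open>Raising to the power \<open>q\<close> permutes the summands cyclically, so the trace is
  a root of \<open>x ^ q - x\<close>.\<close>

lemma cyc_trace_in_range:
  assumes "a < N" "x ^ q ^ cyc_card q N a = x"
  shows "cyc_trace q N a x \<in> range \<iota>"
proof -
  obtain n where n: "cyc_card q N a = Suc n" using cyc_card_pos[OF assms(1)] by (cases "cyc_card q N a") auto
  have "cyc_trace q N a x ^ q ^ 1 = (\<Sum>i<Suc n. x ^ q ^ Suc i)"
    unfolding cyc_trace_def frobenius_sum n by (simp add: mult.commute flip: power_mult)
  also have "\<dots> = cyc_trace q N a x"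
    using assms(2) unfolding cyc_trace_def n
    by (subst sum.lessThan_Suc, subst sum.lessThan_Suc_shift) (simp add: add.commute)
  finally show ?thesis by (simp add: range_iota)
qed

text \<open>The polynomials of the theorem with a general constant \<open>c\<close>. The factor
  \<open>x0\<close> only removes the value at \<open>(0, 1)\<close>, so \<open>affine_vec\<close>
  and \<open>proj_vec\<close> agree on the affine points.\<close>

definition affine_vec :: "nat \<Rightarrow> 'a \<Rightarrow> 'a \<times> 'a \<Rightarrow> 'a" where
  "affine_vec a c = ev N (cyc_trace q N a (const2 c * x0 * x1 ^ a))"

definition proj_vec :: "nat \<Rightarrow> 'a \<Rightarrow> 'a \<times> 'a \<Rightarrow> 'a" where
  "proj_vec a c = ev N (cyc_trace q N a (const2 c * x1 ^ a))"

lemma vec_simps: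
  "z \<in> Y_pts N \<Longrightarrow> affine_vec a c (1, z) = cyc_trace q N a (c * z ^ a)"
  "z \<in> Y_pts N \<Longrightarrow> proj_vec a c (1, z) = cyc_trace q N a (c * z ^ a)"
  "proj_vec a c (0, 1) = cyc_trace q N a c"
  "P \<notin> X_pts N \<Longrightarrow> affine_vec a c P = 0" "P \<notin> X_pts N \<Longrightarrow> proj_vec a c P = 0"
  by (simp_all add: affine_vec_def proj_vec_def ev_def eval2_cyc_trace)

lemma affine_vec_inf [simp]: "affine_vec a c (0, 1) = 0"
  using q_gt_1 unfolding affine_vec_def ev_def eval2_cyc_trace
  by (simp add: cyc_trace_def power_0_left)

lemma cf_proj_vec_eq: "cf (proj_vec a c) j = cf (affine_vec a c) j"
  by (rule cf_cong) (simp add: vec_simps)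

context
  fixes a :: nat and c :: 'a
  assumes a: "a < N" and c: "c ^ q ^ cyc_card q N a = c"
begin

lemma trace_monomial_in_range:
  assumes "z \<in> Y_pts N"
  shows "cyc_trace q N a (c * z ^ a) \<in> range \<iota>"
proof (rule cyc_trace_in_range[OF a])
  have "(z ^ a) ^ q ^ cyc_card q N a = z ^ orb (cyc_card q N a) a"
    using assms by (simp add: orb_def power_Z_rep mult.commute flip: power_mult)
  then show "(c * z ^ a) ^ q ^ cyc_card q N a = c * z ^ a"
    by (simp add: power_mult_distrib c orb_cyc_card[OF a])
qed

lemma affine_vec_subfield: "affine_vec a c \<in> subfield_vectors \<iota> N"
  unfolding subfield_vectors_def
proof (intro CollectI conjI ballI allI impI)
  fix P :: "'a \<times> 'a" assume "P \<in> X_pts N"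
  then show "affine_vec a c P \<in> range \<iota>"
  proof (cases rule: X_pts_cases)
    case 2
    then show ?thesis using rangeI[of \<iota> 0] by simp
  qed (simp add: vec_simps trace_monomial_in_range)
qed (simp add: vec_simps)

lemma proj_vec_subfield: "proj_vec a c \<in> subfield_vectors \<iota> N"
  unfolding subfield_vectors_def
proof (intro CollectI conjI ballI allI impI)
  fix P :: "'a \<times> 'a" assume "P \<in> X_pts N"
  then show "proj_vec a c P \<in> range \<iota>"
    by (cases rule: X_pts_cases)
      (auto simp: vec_simps trace_monomial_in_range cyc_trace_in_range[OF a c])
qed (simp add: vec_simps)

text \<open>On the affine points the conjugates of \<open>c * z ^ a\<close> are monomials with
  exponents \<open>orb i a < N\<close>, so uniqueness of interpolation applies.\<close>

lemma cf_affine_vec: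
  assumes "j < N"
  shows "cf (affine_vec a c) j = (\<Sum>i<cyc_card q N a. if orb i a = j then c ^ q ^ i else 0)"
proof (rule cf_eqI[where a = "\<lambda>j. \<Sum>i<cyc_card q N a. if orb i a = j then c ^ q ^ i else 0", OF _ assms])
  fix z :: 'a assume z: "z \<in> Y_pts N"
  have "(\<Sum>j<N. (\<Sum>i<cyc_card q N a. if orb i a = j then c ^ q ^ i else 0) * z ^ j) =
      (\<Sum>j<N. \<Sum>i<cyc_card q N a. if orb i a = j then c ^ q ^ i * z ^ j else 0)"
    unfolding sum_distrib_right by (intro sum.cong refl) simp
  also have "\<dots> = (\<Sum>i<cyc_card q N a. \<Sum>j<N. if orb i a = j then c ^ q ^ i * z ^ j else 0)"
    by (rule sum.swap)
  also have "\<dots> = (\<Sum>i<cyc_card q N a. c ^ q ^ i * z ^ orb i a)"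
    by simp
  also have "\<dots> = affine_vec a c (1, z)"
  proof -
    have "z ^ orb i a = (z ^ a) ^ q ^ i" for i
      using z by (simp add: orb_def power_Z_rep mult.commute flip: power_mult)
    then show ?thesis using z by (simp add: vec_simps cyc_trace_def power_mult_distrib)
  qed
  finally show "affine_vec a c (1, z) =
      (\<Sum>j<N. (\<Sum>i<cyc_card q N a. if orb i a = j then c ^ q ^ i else 0) * z ^ j)" ..
qed

lemma cf_affine_vec_outside:
  assumes "j < N" "j \<notin> cyc q N a"
  shows "cf (affine_vec a c) j = 0"
proof -
  have "orb i a \<noteq> j" for i using assms(2) orb_in_cyc by blast
  then show ?thesis by (simp add: cf_affine_vec[OF assms(1)])
qed

lemma cf_affine_vec_self: "cf (affine_vec a c) a = c"
proof -
  have "cf (affine_vec a c) a = (\<Sum>i<cyc_card q N a. if i = 0 then c ^ q ^ i else 0)"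
    unfolding cf_affine_vec[OF a]
  proof (intro sum.cong refl)
    fix i assume i: "i \<in> {..<cyc_card q N a}"
    have "orb i a = orb 0 a \<longleftrightarrow> i = 0"
      using i cyc_card_pos[OF a] bij_betw_imp_inj_on[OF bij_betw_orb[OF a]]
      by (auto simp: inj_on_def)
    then show "(if orb i a = a then c ^ q ^ i else 0) = (if i = 0 then c ^ q ^ i else 0)"
      using orb_0[OF a] by simp
  qed
  also have "\<dots> = c" using cyc_card_pos[OF a] by simp
  finally show ?thesis .
qed

end

section \<open>Powers of primitive elements and independent trace families\<close>

context
  fixes n :: nat and \<xi> :: 'a
  assumes n: "n > 0" "n dvd s" and prim: "primitive_element (subfield_of_order (q ^ n)) \<xi>"
begin

lemma primitive_power_fixed: "(\<xi> ^ r) ^ q ^ n = \<xi> ^ r"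
proof -
  have "\<xi> ^ q ^ n = \<xi>" using prim by (simp add: primitive_element_def subfield_of_order_def)
  then have "(\<xi> ^ q ^ n) ^ r = \<xi> ^ r" by simp
  then show ?thesis by (simp add: mult.commute flip: power_mult)
qed

text \<open>Equal conjugates would give \<open>\<xi> ^ q ^ k = \<xi>\<close> with
  \<open>0 < k < n\<close>. As the powers of \<open>\<xi>\<close> exhaust the units of the subfield,
  all its \<open>q ^ n\<close> elements would then be roots of \<open>x ^ q ^ k - x\<close>.\<close>

lemma inj_on_conjugates: "inj_on (\<lambda>i. \<xi> ^ q ^ i) {..<n}"
proof (rule linorder_inj_onI)
  fix i j assume ij: "i < j" "i \<in> {..<n}" "j \<in> {..<n}"
  show "\<xi> ^ q ^ i \<noteq> \<xi> ^ q ^ j"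
  proof
    assume eq: "\<xi> ^ q ^ i = \<xi> ^ q ^ j"
    define k where "k = j - i"
    have k: "0 < k" "k < n" using ij by (auto simp: k_def)
    have "(\<xi> ^ q ^ i) ^ q ^ (n - i) = (\<xi> ^ q ^ j) ^ q ^ (n - i)" by (simp only: eq)
    moreover have "i + (n - i) = n" "j + (n - i) = n + k" using ij by (auto simp: k_def)
    ultimately have "\<xi> ^ q ^ n = \<xi> ^ q ^ (n + k)"
      by (simp only: power_mult[symmetric] power_add[symmetric])
    then have "\<xi> = \<xi> ^ q ^ k"
      using primitive_power_fixed[of 1] by (simp add: power_add power_mult)
    then have "(\<xi> ^ r) ^ q ^ k = \<xi> ^ r" for r
      by (metis mult.commute power_mult)
    moreover have "subfield_of_order (q ^ n) \<subseteq> insert 0 (range (\<lambda>r. \<xi> ^ r))"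
      using prim by (auto simp: primitive_element_def)
    ultimately have "subfield_of_order (q ^ n) \<subseteq> {x::'a. x ^ q ^ k = x}"
      using q_gt_1 by (auto simp: power_0_left)
    then have "q ^ n \<le> card {x::'a. x ^ q ^ k = x}"
      by (subst card_subfield_of_order[OF n, symmetric], rule card_mono[rotated]) simp
    also have "\<dots> \<le> q ^ k"
      by (intro card_fixed_power_le one_less_power q_gt_1 k)
    finally show False using k q_gt_1 by simp
  qed
qed auto

text \<open>A relation is a polynomial over the small field of degree below \<open>n\<close>; with
  \<open>\<xi>\<close> it has all \<open>n\<close> distinct conjugates as roots.\<close>

lemma primitive_powers_independent:
  assumes "(\<Sum>r<n. \<iota> (c r) * \<xi> ^ r) = 0" and "r < n"
  shows "c r = 0"
proof -
  define P where "P = (\<Sum>r<n. monom (\<iota> (c r)) r)"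
  have "P = 0"
  proof (rule ccontr)
    assume "P \<noteq> 0"
    have "poly P (\<xi> ^ q ^ i) = 0" for i
    proof -
      have "poly P (\<xi> ^ q ^ i) = (\<Sum>r<n. \<iota> (c r) * \<xi> ^ r) ^ q ^ i"
        by (simp add: P_def poly_sum poly_monom frobenius_sum power_mult_distrib mult.commute
            flip: power_mult)
      then show ?thesis using assms(1) q_gt_1 by (simp add: power_0_left)
    qed
    then have "(\<lambda>i. \<xi> ^ q ^ i) ` {..<n} \<subseteq> {x. poly P x = 0}" by auto
    then have "n \<le> card {x. poly P x = 0}"
      using card_mono[OF poly_roots_finite[OF \<open>P \<noteq> 0\<close>]] card_image[OF inj_on_conjugates]
      by (metis card_lessThan)
    also have "\<dots> \<le> degree P" by (rule card_poly_roots_bound) fact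
    also have "degree P \<le> n - 1"
      unfolding P_def by (rule degree_sum_le) (auto intro: order_trans[OF degree_monom_le])
    finally show False using n by simp
  qed
  then have "coeff P r = 0" by simp
  then show ?thesis using assms(2) by (simp add: P_def coeff_sum coeff_monom)
qed

text \<open>By counting: independence makes the \<open>q ^ n\<close> combinations distinct, and they
  lie in a subfield with \<open>q ^ n\<close> elements.\<close>

lemma primitive_powers_span:
  assumes "x ^ q ^ n = x"
  obtains c where "x = (\<Sum>r<n. \<iota> (c r) * \<xi> ^ r)"
proof -
  let ?F = "{..<n} \<rightarrow>\<^sub>E (UNIV :: 'k set)"
  let ?f = "\<lambda>c. \<Sum>r<n. \<iota> (c r) * \<xi> ^ r"
  have "inj_on ?f ?F"
  proof (rule inj_onI)
    fix c e assume ce: "c \<in> ?F" "e \<in> ?F" "?f c = ?f e"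
    then have "(\<Sum>r<n. \<iota> (c r - e r) * \<xi> ^ r) = 0"
      by (simp add: left_diff_distrib sum_subtractf)
    then have "c r - e r = 0" if "r < n" for r
      using primitive_powers_independent[of "\<lambda>r. c r - e r"] that by simp
    then show "c = e" using ce by (intro PiE_ext) auto
  qed
  then have "card (?f ` ?F) = q ^ n" by (simp add: card_image card_funcsetE card_K)
  moreover have "?f ` ?F \<subseteq> subfield_of_order (q ^ n)"
    unfolding subfield_of_order_def
    by (intro image_subsetI CollectI)
      (simp only: frobenius_sum power_mult_distrib primitive_power_fixed iota_power)
  ultimately have "?f ` ?F = subfield_of_order (q ^ n)"
    using card_subfield_of_order[OF n] by (intro card_subset_eq) simp_all
  then have "x \<in> ?f ` ?F" using assms by (simp add: subfield_of_order_def)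
  then show ?thesis using that by auto
qed

end

section \<open>Families of trace vectors on distinct cyclotomic sets\<close>

lemma subspace_subfield_vectors: "V.subspace (subfield_vectors \<iota> N)"
proof (rule V.subspaceI)
  fix c v w assume v: "v \<in> subfield_vectors \<iota> N" and w: "w \<in> subfield_vectors \<iota> N"
  show "v + w \<in> subfield_vectors \<iota> N"
    using v w unfolding subfield_vectors_def
    by (auto simp: image_iff) (metis iota_simps(2))
  show "vscale \<iota> c v \<in> subfield_vectors \<iota> N"
    using v unfolding subfield_vectors_def
    by (auto simp: image_iff vscale_def) (metis iota_simps(3))
qed (auto simp: subfield_vectors_def image_iff intro: exI[of _ 0])

text \<open>Only the affine part of \<open>w a r\<close> is prescribed, so one family may mix affine
  and projective trace vectors.\<close>

context
  fixes R :: "nat set" and \<xi> :: "nat \<Rightarrow> 'a" and w :: "nat \<Rightarrow> nat \<Rightarrow> 'a \<times> 'a \<Rightarrow> 'a"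
  assumes R: "R \<subseteq> {..<N}"
    and disj: "\<And>a b. a \<in> R \<Longrightarrow> b \<in> R \<Longrightarrow> b \<in> cyc q N a \<Longrightarrow> b = a"
    and prim: "\<And>a. a \<in> R \<Longrightarrow> primitive_element (subfield_of_order (q ^ cyc_card q N a)) (\<xi> a)"
    and w: "\<And>a r j. a \<in> R \<Longrightarrow> cf (w a r) j = cf (affine_vec a (\<xi> a ^ r)) j"
    and w_sub: "\<And>a r. a \<in> R \<Longrightarrow> w a r \<in> subfield_vectors \<iota> N"
begin

lemma
  assumes a: "a \<in> R"
  shows family_n: "cyc_card q N a > 0" "cyc_card q N a dvd s"
    and family_cf_self: "cf (w a r) a = \<xi> a ^ r"
    and family_cf_outside: "j < N \<Longrightarrow> j \<notin> cyc q N a \<Longrightarrow> cf (w a r) j = 0"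
proof -
  have aN: "a < N" using a R by auto
  show n: "cyc_card q N a > 0" "cyc_card q N a dvd s"
    using cyc_card_pos cyc_card_dvd aN by auto
  have fixed: "(\<xi> a ^ r) ^ q ^ cyc_card q N a = \<xi> a ^ r"
    by (rule primitive_power_fixed[OF n prim[OF a]])
  show "cf (w a r) a = \<xi> a ^ r"
    using cf_affine_vec_self[OF aN fixed] w[OF a] by simp
  show "j < N \<Longrightarrow> j \<notin> cyc q N a \<Longrightarrow> cf (w a r) j = 0"
    using cf_affine_vec_outside[OF aN fixed] w[OF a] by simp
qed

lemma finite_R: "finite R"
  using R finite_subset by blast

lemma cf_family_sum:
  assumes a: "a \<in> R"
  shows "cf (\<Sum>(b, r)\<in>Sigma R (\<lambda>b. {..<cyc_card q N b}). vscale \<iota> (c (b, r)) (w b r)) a =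
    (\<Sum>r<cyc_card q N a. \<iota> (c (a, r)) * \<xi> a ^ r)"
proof -
  have "cf (\<Sum>(b, r)\<in>Sigma R (\<lambda>b. {..<cyc_card q N b}). vscale \<iota> (c (b, r)) (w b r)) a =
      (\<Sum>b\<in>R. \<Sum>r<cyc_card q N b. \<iota> (c (b, r)) * cf (w b r) a)"
    unfolding cf_sum by (subst sum.Sigma) (auto simp: finite_R cf_vscale intro!: sum.cong)
  also have "\<dots> = (\<Sum>b\<in>{a}. \<Sum>r<cyc_card q N b. \<iota> (c (b, r)) * cf (w b r) a)"
  proof (rule sum.mono_neutral_right)
    show "\<forall>b\<in>R - {a}. (\<Sum>r<cyc_card q N b. \<iota> (c (b, r)) * cf (w b r) a) = 0"
    proof
      fix b assume b: "b \<in> R - {a}"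
      then have "a \<notin> cyc q N b" using disj[of b a] a by auto
      then show "(\<Sum>r<cyc_card q N b. \<iota> (c (b, r)) * cf (w b r) a) = 0"
        using family_cf_outside[of b a] a b R by auto
    qed
  qed (use a finite_R in auto)
  finally show ?thesis using family_cf_self[OF a] by simp
qed

lemma independent_trace_family:
  "V.independent ((\<lambda>(a, r). w a r) ` Sigma R (\<lambda>a. {..<cyc_card q N a}))"
proof (rule V.independent_image_family)
  fix c assume c: "(\<Sum>j\<in>Sigma R (\<lambda>a. {..<cyc_card q N a}).
      vscale \<iota> (c j) (case j of (a, r) \<Rightarrow> w a r)) = 0"
  show "\<forall>j\<in>Sigma R (\<lambda>a. {..<cyc_card q N a}). c j = 0"
  proof clarify
    fix a r assume a: "a \<in> R" and r: "r < cyc_card q N a"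
    have "(\<Sum>r<cyc_card q N a. \<iota> (c (a, r)) * \<xi> a ^ r) = cf 0 a"
      unfolding c[symmetric] cf_family_sum[OF a, symmetric]
      by (intro arg_cong2[of _ _ _ _ cf] sum.cong) auto
    then show "c (a, r) = 0"
      using primitive_powers_independent[OF family_n[OF a] prim[OF a], of "\<lambda>r. c (a, r)"] r
      by simp
  qed
qed (use finite_R in auto)

text \<open>The orbit of \<open>a\<close> closes, so \<open>cf v a\<close> lies in the field spanned
  by the powers of \<open>\<xi> a\<close>. Matching one coefficient per cyclotomic set matches its
  conjugates. The value at \<open>(0, 1)\<close> stays open.\<close>

lemma trace_family_interpolates:
  assumes v: "v \<in> subfield_vectors \<iota> N"
    and supp: "\<And>j. j < N \<Longrightarrow> cf v j \<noteq> 0 \<Longrightarrow> \<exists>a\<in>R. j \<in> cyc q N a"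
  shows "\<exists>u \<in> V.span ((\<lambda>(a, r). w a r) ` Sigma R (\<lambda>a. {..<cyc_card q N a})).
    \<forall>j<N. cf u j = cf v j"
proof -
  let ?J = "Sigma R (\<lambda>a. {..<cyc_card q N a})"
  have "\<exists>c. cf v a = (\<Sum>r<cyc_card q N a. \<iota> (c r) * \<xi> a ^ r)" if a: "a \<in> R" for a
  proof -
    have "a < N" using a R by auto
    then have "cf v a ^ q ^ cyc_card q N a = cf v a"
      using cf_orb[OF v, of a "cyc_card q N a"] orb_cyc_card by simp
    then show ?thesis
      using primitive_powers_span[OF family_n[OF a] prim[OF a]] by metis
  qed
  then obtain c where c: "\<And>a. a \<in> R \<Longrightarrow> cf v a = (\<Sum>r<cyc_card q N a. \<iota> (c a r) * \<xi> a ^ r)"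
    by metis
  define u where "u = (\<Sum>(a, r)\<in>?J. vscale \<iota> (c a r) (w a r))"
  have span: "u \<in> V.span ((\<lambda>(a, r). w a r) ` ?J)"
    unfolding u_def by (intro V.span_sum) (auto intro!: V.span_scale[OF V.span_base])
  have u_sub: "u \<in> subfield_vectors \<iota> N"
    by (rule subsetD[OF V.span_minimal[OF _ subspace_subfield_vectors] span]) (use w_sub in auto)
  have rep: "cf u a = cf v a" if "a \<in> R" for a
    using cf_family_sum[OF that, of "\<lambda>(a, r). c a r"] c[OF that] by (simp add: u_def)
  have "cf u j = cf v j" if j: "j < N" for j
  proof (cases "\<exists>a\<in>R. j \<in> cyc q N a")
    case True
    then obtain a i where a: "a \<in> R" "j = orb i a" by (auto simp: cyc_eq_range_orb)
    then show ?thesis using rep cf_orb[OF v] cf_orb[OF u_sub] R by auto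
  next
    case False
    have "cf u j = (\<Sum>p\<in>?J. cf (case p of (a, r) \<Rightarrow> vscale \<iota> (c a r) (w a r)) j)"
      unfolding u_def cf_sum ..
    also have "\<dots> = 0"
      using False family_cf_outside j by (intro sum.neutral) (auto simp: cf_vscale)
    finally show ?thesis using supp[OF j] False by auto
  qed
  then show ?thesis using span by blast
qed

end

text \<open>The generator of index \<open>i\<close> has the single coefficient 1 at
  \<open>i\<close>, and its value at \<open>(0, 1)\<close> is nonzero only for
  \<open>i = Max \<Delta>\<close>, where the power of \<open>x0\<close> is
  \<open>0 ^ 0 = 1\<close>.\<close>

lemma PRS_iff:
  assumes \<Delta>: "\<Delta> \<noteq> {}" "\<Delta> \<subseteq> {..<N}"
  shows "v \<in> PRS N \<Delta> \<longleftrightarrow> (\<forall>P. P \<notin> X_pts N \<longrightarrow> v P = 0) \<and>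
    (\<forall>j<N. j \<notin> \<Delta> \<longrightarrow> cf v j = 0) \<and> v (0, 1) = cf v (Max \<Delta>)"
proof -
  define g :: "nat \<Rightarrow> 'a \<times> 'a \<Rightarrow> 'a" where "g i = ev N (x0 ^ (Max \<Delta> - i) * x1 ^ i)" for i
  have fin: "finite \<Delta>" using \<Delta>(2) finite_subset by blast
  have max: "Max \<Delta> \<in> \<Delta>" using fin \<Delta>(1) by simp
  have g_out: "g i P = 0" if "P \<notin> X_pts N" for i P using that by (simp add: g_def ev_def)
  have g_inf: "g i (0, 1) = (if i = Max \<Delta> then 1 else 0)" if "i \<in> \<Delta>" for i
  proof -
    have "i \<le> Max \<Delta>" using that fin by simp
    then show ?thesis by (simp add: g_def ev_def power_0_left)
  qed
  have g_cf: "cf (g i) j = (if j = i then 1 else 0)" if "i \<in> \<Delta>" "j < N" for i j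
  proof (rule cf_eqI[where a = "\<lambda>j. if j = i then 1 else 0"])
    fix z :: 'a assume "z \<in> Y_pts N"
    then show "g i (1, z) = (\<Sum>j<N. (if j = i then 1 else 0) * z ^ j)"
      using that \<Delta>(2) by (auto simp: g_def ev_def if_distrib[of "\<lambda>x. x * _"] cong: if_cong)
  qed (use that in auto)
  have PRS: "PRS N \<Delta> = L.span (g ` \<Delta>)"
    unfolding PRS_def g_def by (rule arg_cong[where f = L.span]) auto
  let ?S = "{v. (\<forall>P. P \<notin> X_pts N \<longrightarrow> v P = 0) \<and>
    (\<forall>j<N. j \<notin> \<Delta> \<longrightarrow> cf v j = 0) \<and> v (0, 1) = cf v (Max \<Delta>)}"
  have "L.subspace ?S"
    by (rule L.subspaceI) (auto simp: cf_add cf_vscale, auto simp: vscale_def)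
  moreover have "g ` \<Delta> \<subseteq> ?S"
    using \<Delta>(2) max by (auto simp: g_out g_inf g_cf)
  ultimately have sub: "PRS N \<Delta> \<subseteq> ?S" unfolding PRS by (rule L.span_minimal[rotated])
  have "v \<in> PRS N \<Delta>" if v: "v \<in> ?S" for v
  proof -
    define u where "u = (\<Sum>i\<in>\<Delta>. vscale (\<lambda>x. x) (cf v i) (g i))"
    have u: "u \<in> PRS N \<Delta>"
      unfolding PRS u_def by (intro L.span_sum L.span_scale L.span_base) auto
    have cfu: "cf u j = cf v j" if "j < N" for j
    proof -
      have "cf u j = (\<Sum>i\<in>\<Delta>. cf v i * (if j = i then 1 else 0))"
        unfolding u_def cf_sum cf_vscale by (intro sum.cong refl) (use g_cf that in auto)
      also have "\<dots> = (if j \<in> \<Delta> then cf v j else 0)"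
        using fin by (simp add: if_distrib cong: if_cong)
      finally show ?thesis using v that by auto
    qed
    have "u = v"
    proof (rule code_vector_eqI)
      have "u (0, 1) = cf u (Max \<Delta>)" using sub u by blast
      also have "\<dots> = v (0, 1)" using v cfu max \<Delta>(2) by auto
      finally show "u (0, 1) = v (0, 1)" .
    qed (use sub u v cfu in auto)
    then show ?thesis using u by simp
  qed
  then show ?thesis using sub by blast
qed

end

section \<open>The code and its dual\<close>

locale projective_code = projective_points \<iota> p m q s N
  for \<iota> :: "'k::{field,finite} \<Rightarrow> 'a::{field,finite}" and p m q s N :: nat +
  fixes \<Delta> :: "nat set" and d :: nat and \<xi> :: "nat \<Rightarrow> 'a"
  assumes Delta_subset: "\<Delta> \<subseteq> {..<N}" and zero_in_Delta: "0 \<in> \<Delta>" and d_eq: "d = Max \<Delta>"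
    and xi_prim: "\<And>a. a \<in> min_reps q N \<union> {N - 1 - d} \<Longrightarrow>
      primitive_element (subfield_of_order (q ^ cyc_card q N a)) (\<xi> a)"
    and xi_trace: "\<And>a. a \<in> min_reps q N \<union> {N - 1 - d} \<Longrightarrow> cyc_trace q N a (\<xi> a) \<noteq> 0"
begin

abbreviation code where "code \<equiv> PRS_subfield \<iota> N \<Delta>"
abbreviation dual where "dual \<equiv> dual_code \<iota> N (PRS_subfield \<iota> N \<Delta>)"
abbreviation meets_perp where "meets_perp j \<equiv> cyc q N j \<inter> Delta_perp N \<Delta> \<noteq> {}"

lemma d_less: "d < N" and le_d: "j \<in> \<Delta> \<Longrightarrow> j \<le> d"
proof -
  have fin: "finite \<Delta>" using Delta_subset finite_subset by blast
  have "d \<in> \<Delta>" unfolding d_eq by (rule Max_in) (use fin zero_in_Delta in auto)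
  then show "d < N" using Delta_subset by auto
  show "j \<in> \<Delta> \<Longrightarrow> j \<le> d" using fin by (simp add: d_eq)
qed

lemma cyc_sym: "a < N \<Longrightarrow> x \<in> cyc q N a \<Longrightarrow> a \<in> cyc q N x"
  using cyc_eqI by (metis self_in_cyc)

lemma in_cyc_reflect:
  assumes "j < N" "i < N"
  shows "N - 1 - i \<in> cyc q N (N - 1 - j) \<longleftrightarrow> i \<in> cyc q N j"
proof -
  have *: "N - 1 - i \<in> cyc q N (N - 1 - j)" if "j < N" "i \<in> cyc q N j" for i j
    using that by (simp only: cyc_reflect[OF that(1)] image_eqI)
  have "N - 1 - (N - 1 - j) = j" "N - 1 - (N - 1 - i) = i" using assms by auto
  then show ?thesis using *[of j i] *[of "N - 1 - j" "N - 1 - i"] assms by auto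
qed

lemma meets_perp_iff:
  assumes "j < N"
  shows "meets_perp j \<longleftrightarrow> \<not> cyc q N (N - 1 - j) \<subseteq> \<Delta>"
proof -
  have perp: "x \<in> Delta_perp N \<Delta> \<longleftrightarrow> N - 1 - x \<notin> \<Delta>" if x: "x < N" for x
  proof -
    have "x = N - 1 - h \<longleftrightarrow> h = N - 1 - x" if "h \<in> \<Delta>" for h
      using that x Delta_subset by (auto simp: subset_iff)
    then show ?thesis using x by (auto simp: Delta_perp_def)
  qed
  show ?thesis
    unfolding cyc_reflect[OF assms] using perp cyc_subset[of j] by (auto simp: subset_iff)
qed

lemma code_iff:
  "c \<in> code \<longleftrightarrow> c \<in> subfield_vectors \<iota> N \<and> (\<forall>j<N. j \<notin> \<Delta> \<longrightarrow> cf c j = 0) \<and> c (0, 1) = cf c d"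
  unfolding PRS_subfield_def d_eq
  using PRS_iff[OF _ Delta_subset, of c] zero_in_Delta by (auto simp: subfield_vectors_def)

lemma dual_iff:
  "v \<in> dual \<longleftrightarrow> v \<in> subfield_vectors \<iota> N \<and> (\<forall>c\<in>code. v (0, 1) * c (0, 1) =
    (\<Sum>j<N. cf v (N - 1 - j) * cf c j) + cf v (N - 1) * cf c (N - 1))"
proof -
  have "(\<Sum>P\<in>X_pts N. v P * c P) = v (0, 1) * c (0, 1) -
      ((\<Sum>j<N. cf v (N - 1 - j) * cf c j) + cf v (N - 1) * cf c (N - 1))" for c :: "'a \<times> 'a \<Rightarrow> 'a"
    unfolding sum_X_pts pairing by (simp add: algebra_simps)
  then show ?thesis by (simp add: dual_code_def)
qed

text \<open>Coefficients along a cyclotomic set are conjugate, so one index outside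
  \<open>\<Delta>\<close> makes all of them vanish.\<close>

lemma code_cf_eq_0:
  assumes "c \<in> code" "j < N" "\<not> cyc q N j \<subseteq> \<Delta>"
  shows "cf c j = 0"
proof -
  obtain x where x: "x \<in> cyc q N j" "x \<notin> \<Delta>" using assms(3) by blast
  then have "cf c x = 0" using assms(1) cyc_subset by (auto simp: code_iff)
  then show ?thesis using cf_eq_0_iff_cyc[OF _ assms(2) x(1)] assms(1) by (simp add: code_iff)
qed

lemma subspace_dual: "V.subspace dual"
proof (rule V.subspaceI)
  show "0 \<in> dual"
    using subspace_subfield_vectors by (simp add: dual_code_def V.subspace_0)
next
  fix v w assume "v \<in> dual" "w \<in> dual"
  then show "v + w \<in> dual"
    using subspace_subfield_vectors by (simp add: dual_code_def V.subspace_add distrib_right sum.distrib)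
next
  fix c v assume "v \<in> dual"
  then show "vscale \<iota> c v \<in> dual"
    using V.subspace_scale[OF subspace_subfield_vectors]
    by (auto simp: dual_code_def vscale_def mult.assoc simp flip: sum_distrib_left)
qed

lemma min_rep:
  assumes "z < N"
  obtains a where "a \<in> min_reps q N" "a < N" "z \<in> cyc q N a" "cyc q N a = cyc q N z"
proof
  let ?a = "Min (cyc q N z)"
  have a: "?a \<in> cyc q N z" by (rule Min_in) (use self_in_cyc[OF assms] in auto)
  show "?a \<in> min_reps q N" using assms unfolding min_reps_def by (intro CollectI exI[of _ z]) auto
  show "?a < N" using a cyc_subset by auto
  show eq: "cyc q N ?a = cyc q N z" by (rule cyc_eqI[OF assms a])
  then show "z \<in> cyc q N ?a" using assms by simp
qed

lemma min_reps_Min: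
  assumes "a \<in> min_reps q N"
  shows "a < N" "a = Min (cyc q N a)"
proof -
  obtain z where z: "a = Min (cyc q N z)" "z \<le> N - 1" using assms by (auto simp: min_reps_def)
  then have zN: "z < N" using N_gt_1 by simp
  have a: "a \<in> cyc q N z" unfolding z by (rule Min_in) (use self_in_cyc[OF zN] in auto)
  then show "a < N" using cyc_subset by auto
  show "a = Min (cyc q N a)" using cyc_eqI[OF zN a] z by simp
qed

lemma min_reps_disjoint:
  "a \<in> min_reps q N \<Longrightarrow> b \<in> min_reps q N \<Longrightarrow> b \<in> cyc q N a \<Longrightarrow> b = a"
  using cyc_eqI[of a b] min_reps_Min by metis

text \<open>The trace of a constant depends only on the size of the cyclotomic set, so
  \<open>\<xi>\<close> at its least element serves for every \<open>j\<close> in it.\<close>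

lemma trace_nonzero:
  assumes "j < N"
  obtains x :: 'a where "x ^ q ^ cyc_card q N j = x" "cyc_trace q N j x \<noteq> 0"
proof -
  obtain a where a: "a \<in> min_reps q N" "cyc q N a = cyc q N j" using min_rep[OF assms] .
  then have n: "cyc_card q N a = cyc_card q N j" by (simp add: cyc_card_def)
  show ?thesis
    using that[of "\<xi> a"] xi_prim[of a] xi_trace[of a] a n
    by (simp add: cyc_trace_def primitive_element_def subfield_of_order_def)
qed

text \<open>A nonzero coefficient at \<open>j\<close> is detected by a codeword supported on the
  reflected set, which lies in \<open>\<Delta>\<close> and avoids \<open>d\<close>; that codeword
  vanishes at \<open>(0, 1)\<close>.\<close>

lemma dual_cf_eq_0:
  assumes v: "v \<in> dual" and j: "j < N" "\<not> meets_perp j" "j \<notin> cyc q N (N - 1 - d)"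
  shows "cf v j = 0"
proof (rule ccontr)
  assume nz: "cf v j \<noteq> 0"
  let ?j' = "N - 1 - j"
  have j': "?j' < N" using N_gt_1 by simp
  have v_sub: "v \<in> subfield_vectors \<iota> N" using v by (simp add: dual_iff)
  have sub: "cyc q N ?j' \<subseteq> \<Delta>" using j meets_perp_iff by blast
  have "N - 1 - j \<notin> cyc q N d"
    using in_cyc_reflect[of "N - 1 - d" j] j(1,3) d_less by simp
  then have d: "d \<notin> cyc q N ?j'" using cyc_sym[OF j'] by blast
  obtain x :: 'a where x: "x ^ q ^ cyc_card q N j = x" "cyc_trace q N j x \<noteq> 0"
    using trace_nonzero[OF j(1)] .
  \<comment> \<open>Scaled so that the pairing becomes the nonzero trace of
    \<open>x\<close>.\<close>
  define l where "l = x / cf v j"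
  have "cf v j ^ q ^ cyc_card q N j = cf v j"
    using cf_orb[OF v_sub j(1), of "cyc_card q N j"] orb_cyc_card[OF j(1)] by simp
  then have l: "l ^ q ^ cyc_card q N ?j' = l"
    by (simp only: l_def power_divide x cyc_card_reflect[OF j(1)])
  define f where "f = affine_vec ?j' l"
  have f_sub: "f \<in> subfield_vectors \<iota> N"
    unfolding f_def by (rule affine_vec_subfield[OF j' l])
  have f_out: "cf f i = 0" if "i < N" "i \<notin> cyc q N ?j'" for i
    unfolding f_def by (rule cf_affine_vec_outside[OF j' l that])
  have "f \<in> code"
    unfolding code_iff using f_sub f_out sub d d_less by (auto simp: f_def)
  then have "v (0, 1) * f (0, 1) =
      (\<Sum>i<N. cf v (N - 1 - i) * cf f i) + cf v (N - 1) * cf f (N - 1)"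
    using v unfolding dual_iff by blast
  moreover have "f (0, 1) = 0" by (simp add: f_def)
  ultimately have eq: "(\<Sum>i<N. cf v (N - 1 - i) * cf f i) + cf v (N - 1) * cf f (N - 1) = 0"
    by simp
  \<comment> \<open>The correction term vanishes: \<open>N - 1\<close> in the support would lie in
    \<open>\<Delta>\<close> and so be its maximum \<open>d\<close>, which the support
    avoids.\<close>
  have top: "cf f (N - 1) = 0"
  proof (rule ccontr)
    assume "cf f (N - 1) \<noteq> 0"
    then have *: "N - 1 \<in> cyc q N ?j'" using f_out[of "N - 1"] N_gt_1 by auto
    then have "N - 1 \<in> \<Delta>" using sub by blast
    then have "d = N - 1" using le_d[of "N - 1"] d_less by simp
    then show False using d * by simp
  qed
  have "(\<Sum>i<N. cf v (N - 1 - i) * cf f i) =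
      (\<Sum>i<cyc_card q N ?j'. cf v (N - 1 - orb i ?j') * cf f (orb i ?j'))"
    by (rule sum_over_cyc[OF j']) (use f_out in auto)
  also have "\<dots> = (\<Sum>i<cyc_card q N j. x ^ q ^ i)"
    unfolding cyc_card_reflect[OF j(1)]
  proof (intro sum.cong refl)
    fix i
    have "N - 1 - orb i ?j' = orb i j"
      unfolding orb_reflect[OF j(1)] using orb_less[of i j] by linarith
    then have "cf v (N - 1 - orb i ?j') = cf v j ^ q ^ i" by (simp only: cf_orb[OF v_sub j(1)])
    moreover have "cf f (orb i ?j') = l ^ q ^ i"
      using cf_orb[OF f_sub j'] cf_affine_vec_self[OF j' l] by (simp add: f_def)
    ultimately show "cf v (N - 1 - orb i ?j') * cf f (orb i ?j') = x ^ q ^ i"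
      using nz by (simp add: l_def power_divide)
  qed
  also have "\<dots> = cyc_trace q N j x" by (simp add: cyc_trace_def)
  finally show False using eq top x(2) by simp
qed

text \<open>Pairing with a codeword of value 1 at \<open>(0, 1)\<close> expresses the value of a
  dual vector there through its coefficients.\<close>

lemma dual_inf_unique:
  assumes d: "cyc q N d \<subseteq> \<Delta>" and uv: "u \<in> dual" "v \<in> dual" "\<And>j. j < N \<Longrightarrow> cf u j = cf v j"
  shows "u (0, 1) = v (0, 1)"
proof -
  have one: "(1::'a) ^ q ^ cyc_card q N d = 1" by simp
  \<comment> \<open>The affine vector has coefficient 1 at \<open>d\<close> but vanishes at
    \<open>(0, 1)\<close>; for a codeword both must agree.\<close>
  define f where "f = (affine_vec d 1)((0, 1) := 1)"
  have cf_f: "cf f j = cf (affine_vec d 1) j" for j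
    by (rule cf_cong) (simp add: f_def)
  have "(1::'a) \<in> range \<iota>" using rangeI[of \<iota> 1] by simp
  then have "f \<in> subfield_vectors \<iota> N"
    using affine_vec_subfield[OF d_less one] by (auto simp: subfield_vectors_def f_def)
  then have f: "f \<in> code"
    unfolding code_iff cf_f
    using d cf_affine_vec_outside[OF d_less one] cf_affine_vec_self[OF d_less one]
    by (auto simp: f_def)
  have "(\<Sum>j<N. cf u (N - 1 - j) * cf f j) = (\<Sum>j<N. cf v (N - 1 - j) * cf f j)"
    by (intro sum.cong refl) (simp add: uv(3))
  moreover have "cf u (N - 1) = cf v (N - 1)" using uv(3) N_gt_1 by simp
  moreover have "w (0, 1) * f (0, 1) =
      (\<Sum>j<N. cf w (N - 1 - j) * cf f j) + cf w (N - 1) * cf f (N - 1)" if "w \<in> dual" for w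
    using that f unfolding dual_iff by blast
  ultimately have "u (0, 1) * f (0, 1) = v (0, 1) * f (0, 1)" using uv(1,2) by simp
  then show ?thesis by (simp add: f_def)
qed

text \<open>The supports never meet in the pairing: if \<open>cyc q N j\<close> lies in
  \<open>\<Delta>\<close>, then \<open>v\<close> has no coefficient at \<open>N - 1 - j\<close>;
  otherwise codewords have none at \<open>j\<close>.\<close>

lemma in_dualI:
  assumes v: "v \<in> subfield_vectors \<iota> N"
    and supp: "\<And>j. j < N \<Longrightarrow> cf v j \<noteq> 0 \<Longrightarrow> meets_perp j"
    and inf: "v (0, 1) = 0 \<or> \<not> cyc q N d \<subseteq> \<Delta>"
  shows "v \<in> dual"
  unfolding dual_iff
proof (intro conjI ballI v)
  fix c assume c: "c \<in> code"
  have "c (0, 1) = cf c d" using c by (simp add: code_iff)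
  then have zero: "v (0, 1) * c (0, 1) = 0" using inf code_cf_eq_0[OF c d_less] by auto
  have "cf v (N - 1 - j) * cf c j = 0" if j: "j < N" for j
  proof (cases "cyc q N j \<subseteq> \<Delta>")
    case True
    then have "\<not> meets_perp (N - 1 - j)" using meets_perp_iff[of "N - 1 - j"] j by simp
    moreover have "N - 1 - j < N" using j by simp
    ultimately show ?thesis using supp by fastforce
  qed (use code_cf_eq_0[OF c j] in simp)
  then have "(\<Sum>j<N. cf v (N - 1 - j) * cf c j) = 0" by (intro sum.neutral) simp
  \<comment> \<open>The reflection of \<open>N - 1\<close> is 0, whose cyclotomic set
    \<open>{0}\<close> lies in \<open>\<Delta>\<close>.\<close>
  moreover have "cf v (N - 1) = 0"
    using supp[of "N - 1"] meets_perp_iff[of "N - 1"] N_gt_1 zero_in_Delta cyc_0 by auto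
  ultimately show "v (0, 1) * c (0, 1) =
      (\<Sum>j<N. cf v (N - 1 - j) * cf c j) + cf v (N - 1) * cf c (N - 1)" by (simp add: zero)
qed

text \<open>If \<open>cyc q N d \<subseteq> \<Delta>\<close>, the coefficient \<open>cf c d\<close> of a codeword lies in the
  small field and is therefore constant on \<open>cyc q N d\<close>, so that the pairing with a trace
  supported on the reflected set is the value of that trace at \<open>(1, 1)\<close>.\<close>

lemma proj_vec_in_dual:
  assumes x: "x ^ q ^ cyc_card q N (N - 1 - d) = x"
  shows "proj_vec (N - 1 - d) x \<in> dual"
  unfolding dual_iff
proof (intro conjI ballI)
  let ?b = "N - 1 - d" and ?v = "proj_vec (N - 1 - d) x"
  have b: "?b < N" using N_gt_1 by simp
  show "?v \<in> subfield_vectors \<iota> N" by (rule proj_vec_subfield[OF b x])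
  have v_out: "cf ?v j = 0" if "j < N" "j \<notin> cyc q N ?b" for j
    using cf_affine_vec_outside[OF b x that] by (simp add: cf_proj_vec_eq)
  fix c assume c: "c \<in> code"
  have c_inf: "c (0, 1) = cf c d" and c_sub: "c \<in> subfield_vectors \<iota> N"
    using c by (simp_all add: code_iff)
  have "cf c d \<in> range \<iota>" using c_sub by (auto simp: subfield_vectors_def simp flip: c_inf)
  then have const: "cf c j = cf c d" if "j \<in> cyc q N d" for j
    using that cf_orb[OF c_sub d_less] by (auto simp: cyc_eq_range_orb)
  have "(\<Sum>j<N. cf ?v (N - 1 - j) * cf c j) = (\<Sum>j<N. cf ?v (N - 1 - j) * cf c d)"
  proof (intro sum.cong refl)
    fix j assume "j \<in> {..<N}"
    then have j: "j < N" by simp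
    show "cf ?v (N - 1 - j) * cf c j = cf ?v (N - 1 - j) * cf c d"
    proof (cases "j \<in> cyc q N d")
      case False
      then have "cf ?v (N - 1 - j) = 0" using in_cyc_reflect[OF d_less j] j by (intro v_out) auto
      then show ?thesis by simp
    qed (simp add: const)
  qed
  also have "\<dots> = (\<Sum>j<N. cf ?v j) * cf c d"
    using sum.nat_diff_reindex[of "cf ?v" N] by (simp flip: sum_distrib_right)
  also have "(\<Sum>j<N. cf ?v j) = ?v (1, 1)" by (simp add: eval_cf)
  also have "?v (1, 1) = ?v (0, 1)" by (simp add: vec_simps)
  finally have "(\<Sum>j<N. cf ?v (N - 1 - j) * cf c j) = ?v (0, 1) * c (0, 1)" by (simp add: c_inf)
  \<comment> \<open>A nonzero coefficient of \<open>?v\<close> at \<open>N - 1\<close> forces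
    \<open>d = 0\<close>, and then \<open>N - 1\<close> exceeds every element of
    \<open>\<Delta>\<close>.\<close>
  moreover have "cf ?v (N - 1) * cf c (N - 1) = 0"
  proof (cases "N - 1 \<in> cyc q N ?b")
    case True
    then have "?b \<in> cyc q N (N - 1)" by (rule cyc_sym[OF b])
    then have "d = 0" using d_less by (simp only: cyc_top) auto
    then have "N - 1 \<notin> \<Delta>" using le_d[of "N - 1"] N_gt_1 by auto
    then show ?thesis using c N_gt_1 by (simp add: code_iff)
  qed (use v_out[of "N - 1"] N_gt_1 in simp)
  ultimately show "?v (0, 1) * c (0, 1) =
      (\<Sum>j<N. cf ?v (N - 1 - j) * cf c j) + cf ?v (N - 1) * cf c (N - 1)" by simp
qed

section \<open>The two bases of the dual code\<close>

abbreviation A_perp where "A_perp \<equiv> {a \<in> min_reps q N. meets_perp a}"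

lemma xi_power_fixed:
  assumes "a \<in> min_reps q N \<union> {N - 1 - d}"
  shows "(\<xi> a ^ r) ^ q ^ cyc_card q N a = \<xi> a ^ r"
proof -
  have "a < N" using assms min_reps_Min N_gt_1 by auto
  then show ?thesis
    by (intro primitive_power_fixed cyc_card_pos cyc_card_dvd xi_prim assms)
qed

lemma meets_perp_rep:
  assumes "j < N" "meets_perp j"
  shows "\<exists>a\<in>A_perp. j \<in> cyc q N a"
proof -
  obtain a where "a \<in> min_reps q N" "j \<in> cyc q N a" "cyc q N a = cyc q N j"
    using min_rep[OF assms(1)] by metis
  then show ?thesis using assms(2) by auto
qed

lemma affine_family_in_dual:
  assumes "a \<in> A_perp"
  shows "affine_vec a (\<xi> a ^ r) \<in> dual"
proof (rule in_dualI)
  have a: "a < N" and fixed: "(\<xi> a ^ r) ^ q ^ cyc_card q N a = \<xi> a ^ r"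
    using assms min_reps_Min xi_power_fixed by auto
  show "affine_vec a (\<xi> a ^ r) \<in> subfield_vectors \<iota> N" by (rule affine_vec_subfield[OF a fixed])
  fix j assume j: "j < N" "cf (affine_vec a (\<xi> a ^ r)) j \<noteq> 0"
  then have "j \<in> cyc q N a" using cf_affine_vec_outside[OF a fixed] by blast
  then show "meets_perp j" using cyc_eqI[OF a] assms by auto
qed simp

text \<open>The reflected set of \<open>d\<close> misses \<open>Delta_perp\<close>, so it
  contributes a block of its own, and the coefficients of a dual vector determine its value at
  \<open>(0, 1)\<close>.\<close>

lemma basis_if_cyc_d_subset:
  assumes d: "cyc q N d \<subseteq> \<Delta>"
  shows "is_basis_over \<iota> dual
    ((\<Union>a\<in>A_perp. {affine_vec a (\<xi> a ^ r) | r. r < cyc_card q N a}) \<union>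
     {proj_vec (N - 1 - d) (\<xi> (N - 1 - d) ^ r) | r. r < cyc_card q N (N - 1 - d)})"
    (is "is_basis_over \<iota> dual ?B")
proof -
  let ?b = "N - 1 - d"
  have b: "?b < N" using N_gt_1 by simp
  have "N - 1 - ?b = d" using d_less by simp
  then have nb: "\<not> meets_perp ?b" using meets_perp_iff[OF b] d by simp
  define R where "R = insert ?b A_perp"
  define w where "w a r = (if a = ?b then proj_vec a (\<xi> a ^ r) else affine_vec a (\<xi> a ^ r))" for a r
  let ?J = "Sigma R (\<lambda>a. {..<cyc_card q N a})"
  have B: "?B = (\<lambda>(a, r). w a r) ` ?J"
    using nb by (fastforce simp: R_def w_def image_iff)
  have R: "R \<subseteq> {..<N}" using b min_reps_Min by (auto simp: R_def)
  have disj: "y = x" if "x \<in> R" "y \<in> R" "y \<in> cyc q N x" for x y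
  proof -
    have "cyc q N y = cyc q N x" using cyc_eqI[of x y] that R by auto
    then show ?thesis using that nb min_reps_disjoint unfolding R_def by auto
  qed
  have R_sub: "a \<in> min_reps q N \<union> {?b}" if "a \<in> R" for a using that by (auto simp: R_def)
  have fixed: "(\<xi> a ^ r) ^ q ^ cyc_card q N a = \<xi> a ^ r" if "a \<in> R" for a r
    by (rule xi_power_fixed[OF R_sub[OF that]])
  have cf_w: "cf (w a r) j = cf (affine_vec a (\<xi> a ^ r)) j" if "a \<in> R" for a r j
    using cf_proj_vec_eq by (auto simp: w_def)
  have w_dual: "w a r \<in> dual" if "a \<in> R" for a r
    using that proj_vec_in_dual[OF fixed[of ?b]] affine_family_in_dual[of a]
    by (auto simp: w_def R_def)
  then have w_sub: "w a r \<in> subfield_vectors \<iota> N" if "a \<in> R" for a r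
    using that by (auto simp: dual_iff)
  note fam = R disj xi_prim[OF R_sub] cf_w w_sub
  have span: "V.span ?B \<subseteq> dual"
    unfolding B by (rule V.span_minimal[OF _ subspace_dual]) (use w_dual in auto)
  have "v \<in> V.span ?B" if v: "v \<in> dual" for v
  proof -
    have v_sub: "v \<in> subfield_vectors \<iota> N" using v by (simp add: dual_iff)
    have supp: "\<exists>a\<in>R. j \<in> cyc q N a" if "j < N" "cf v j \<noteq> 0" for j
      using dual_cf_eq_0[OF v that(1)] that meets_perp_rep[OF that(1)] unfolding R_def by blast
    obtain u where u: "u \<in> V.span ?B" "\<And>j. j < N \<Longrightarrow> cf u j = cf v j"
      using trace_family_interpolates[OF fam v_sub supp, folded B] by blast
    then have u_dual: "u \<in> dual" using span by blast
    have "u = v"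
    proof (rule code_vector_eqI)
      show "u (0, 1) = v (0, 1)" by (rule dual_inf_unique[OF d u_dual v u(2)])
    qed (use u u_dual v in \<open>auto simp: dual_code_def subfield_vectors_def\<close>)
    then show ?thesis using u by simp
  qed
  then have "V.span ?B = dual" using span by blast
  moreover have "V.independent ?B"
    unfolding B by (rule independent_trace_family[OF fam])
  ultimately show ?thesis by (simp add: is_basis_over_def)
qed

text \<open>The reflected set of \<open>d\<close> meets \<open>Delta_perp\<close>, so the affine
  vectors already provide all coefficients. The value at \<open>(0, 1)\<close> is one free
  dimension, supplied by a single projective vector of nonzero trace.\<close>

lemma basis_if_not_cyc_d_subset:
  assumes d: "\<not> cyc q N d \<subseteq> \<Delta>"
  shows "is_basis_over \<iota> dual
    (insert (proj_vec (N - 1 - d) (\<xi> (N - 1 - d)))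
      (\<Union>a\<in>A_perp. {affine_vec a (\<xi> a ^ r) | r. r < cyc_card q N a}))"
    (is "is_basis_over \<iota> dual (insert ?e ?B)")
proof -
  let ?b = "N - 1 - d"
  have b: "?b < N" using N_gt_1 by simp
  have "N - 1 - ?b = d" using d_less by simp
  then have mb: "meets_perp ?b" using meets_perp_iff[OF b] d by simp
  have fixb: "\<xi> ?b ^ q ^ cyc_card q N ?b = \<xi> ?b"
    using xi_power_fixed[of ?b 1] by simp
  have e_inf: "?e (0, 1) \<noteq> 0" using xi_trace[of ?b] by (simp add: vec_simps)
  have e_dual: "?e \<in> dual" by (rule proj_vec_in_dual[OF fixb])
  let ?J = "Sigma A_perp (\<lambda>a. {..<cyc_card q N a})"
  let ?w = "\<lambda>a r. affine_vec a (\<xi> a ^ r)"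
  have B: "?B = (\<lambda>(a, r). ?w a r) ` ?J" by (fastforce simp: image_iff)
  have R: "A_perp \<subseteq> {..<N}" using min_reps_Min by auto
  have R_sub: "a \<in> min_reps q N \<union> {?b}" if "a \<in> A_perp" for a using that by auto
  have disj: "y = x" if "x \<in> A_perp" "y \<in> A_perp" "y \<in> cyc q N x" for x y
    using that min_reps_disjoint by auto
  have w_sub: "?w a r \<in> subfield_vectors \<iota> N" if "a \<in> A_perp" for a r
    using affine_family_in_dual[OF that] by (simp add: dual_iff)
  note fam = R disj xi_prim[OF R_sub] refl w_sub
  have "?B \<subseteq> {v. v (0, 1) = 0}" by auto
  moreover have "V.subspace {v. v (0, 1) = 0}"
    by (rule V.subspaceI) (auto simp: vscale_def)
  ultimately have span_inf: "V.span ?B \<subseteq> {v. v (0, 1) = 0}" by (rule V.span_minimal)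
  have span: "V.span (insert ?e ?B) \<subseteq> dual"
    by (rule V.span_minimal[OF _ subspace_dual]) (use e_dual affine_family_in_dual in auto)
  have "v \<in> V.span (insert ?e ?B)" if v: "v \<in> dual" for v
  proof -
    have "v (0, 1) \<in> range \<iota>" "?e (0, 1) \<in> range \<iota>"
      using v e_dual by (auto simp: dual_iff subfield_vectors_def)
    then obtain y z where yz: "v (0, 1) = \<iota> y" "?e (0, 1) = \<iota> z" by auto
    then have z: "z \<noteq> 0" using e_inf by auto
    \<comment> \<open>Both values at \<open>(0, 1)\<close> come from the small field, so a scalar
      there removes that of \<open>v\<close> by subtracting a multiple of \<open>?e\<close>.\<close>
    define t where "t = y / z"
    have t: "\<iota> t * ?e (0, 1) = v (0, 1)"
      unfolding yz iota_simps(3)[symmetric] using z by (simp add: t_def)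
    define v' where "v' = v - vscale \<iota> t ?e"
    have v': "v' \<in> dual"
      unfolding v'_def by (intro V.subspace_diff V.subspace_scale subspace_dual v e_dual)
    have v'_inf: "v' (0, 1) = 0" using t by (simp add: v'_def vscale_def)
    have v'_sub: "v' \<in> subfield_vectors \<iota> N" using v' by (simp add: dual_iff)
    have supp: "\<exists>a\<in>A_perp. j \<in> cyc q N a" if "j < N" "cf v' j \<noteq> 0" for j
    proof (rule meets_perp_rep[OF that(1)])
      show "meets_perp j"
      proof (cases "j \<in> cyc q N ?b")
        case True
        then show ?thesis using cyc_eqI[OF b True] mb by simp
      qed (use dual_cf_eq_0[OF v' that(1)] that(2) in blast)
    qed
    obtain u where u: "u \<in> V.span ?B" "\<And>j. j < N \<Longrightarrow> cf u j = cf v' j"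
      using trace_family_interpolates[OF fam v'_sub supp, folded B] by blast
    have u_dual: "u \<in> dual" using u(1) span V.span_mono[of ?B "insert ?e ?B"] by blast
    have "u = v'"
    proof (rule code_vector_eqI)
      show "u (0, 1) = v' (0, 1)" using span_inf u(1) v'_inf by auto
    qed (use u u_dual v' in \<open>auto simp: dual_code_def subfield_vectors_def\<close>)
    then have "v = u + vscale \<iota> t ?e" by (simp add: v'_def)
    moreover have "u \<in> V.span (insert ?e ?B)" using u(1) V.span_mono[of ?B "insert ?e ?B"] by blast
    moreover have "vscale \<iota> t ?e \<in> V.span (insert ?e ?B)" by (intro V.span_scale V.span_base) simp
    ultimately show ?thesis by (simp add: V.span_add)
  qed
  then have "V.span (insert ?e ?B) = dual" using span by blast
  moreover have "V.independent (insert ?e ?B)"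
  proof (rule V.independent_insertI)
    show "?e \<notin> V.span ?B" using span_inf e_inf by blast
    show "V.independent ?B" unfolding B by (rule independent_trace_family[OF fam])
  qed
  ultimately show ?thesis by (simp add: is_basis_over_def)
qed

end

theorem theorem4p14:
  fixes p m q s N d :: nat
    and \<Delta> :: "nat set"
    and \<iota> :: "'k::{field,finite} \<Rightarrow> 'a::{field,finite}"
    and \<xi> :: "nat \<Rightarrow> 'a"
  assumes "prime p" and "m \<ge> 1" and "q = p ^ m" and "s \<ge> 1"
    and "CARD('k) = q" and "CARD('a) = q ^ s" and "field_embedding \<iota>"
    and "N > 1" and "(N - 1) dvd (q ^ s - 1)" and "p dvd N"
    and "\<Delta> \<noteq> {}" and "\<Delta> \<subseteq> {0..N - 1}" and "0 \<in> \<Delta>" and "d = Max \<Delta>"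
    and "\<And>a. a \<in> min_reps q N \<union> {N - 1 - d} \<Longrightarrow>
           primitive_element (subfield_of_order (q ^ cyc_card q N a)) (\<xi> a) \<and>
           cyc_trace q N a (\<xi> a) \<noteq> 0"
  shows
    "(cyc q N d \<subseteq> \<Delta> \<longrightarrow>
        is_basis_over \<iota> (dual_code \<iota> N (PRS_subfield \<iota> N \<Delta>))
          (ev N `
            ((\<Union>a\<in>{a \<in> min_reps q N. cyc q N a \<inter> Delta_perp N \<Delta> \<noteq> {}}.
                {cyc_trace q N a (const2 (\<xi> a ^ r) * x0 * x1 ^ a) | r. r \<le> cyc_card q N a - 1})
             \<union> {cyc_trace q N (N - 1 - d) (const2 (\<xi> (N - 1 - d) ^ r) * x1 ^ (N - 1 - d)) | r.
                  r \<le> cyc_card q N (N - 1 - d) - 1})))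
     \<and> (\<not> cyc q N d \<subseteq> \<Delta> \<longrightarrow>
        is_basis_over \<iota> (dual_code \<iota> N (PRS_subfield \<iota> N \<Delta>))
          (ev N `
            ((\<Union>a\<in>{a \<in> min_reps q N. cyc q N a \<inter> Delta_perp N \<Delta> \<noteq> {}}.
                {cyc_trace q N a (const2 (\<xi> a ^ r) * x0 * x1 ^ a) | r. r \<le> cyc_card q N a - 1})
             \<union> {cyc_trace q N (N - 1 - d) (const2 (\<xi> (N - 1 - d)) * x1 ^ (N - 1 - d))})))"
proof -
  interpret projective_code \<iota> p m q s N \<Delta> d \<xi>
  proof
    have "j < N" if "j \<in> \<Delta>" for j
      using that assms(8,12) by (auto simp: subset_iff)
    then show "\<Delta> \<subseteq> {..<N}" by auto
  qed (use assms in auto)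
  \<comment> \<open>Cyclotomic sets are nonempty, so the truncated subtraction is harmless.\<close>
  have le: "r \<le> cyc_card q N a - 1 \<longleftrightarrow> r < cyc_card q N a" if "a < N" for a r
    using cyc_card_pos[OF that] by auto
  have affine: "ev N ` (\<Union>a\<in>A_perp.
        {cyc_trace q N a (const2 (\<xi> a ^ r) * x0 * x1 ^ a) | r. r \<le> cyc_card q N a - 1}) =
      (\<Union>a\<in>A_perp. {affine_vec a (\<xi> a ^ r) | r. r < cyc_card q N a})"
    unfolding image_UN affine_vec_def using le min_reps_Min(1)
    by (intro SUP_cong refl) auto
  have proj: "ev N ` {cyc_trace q N (N - 1 - d) (const2 (\<xi> (N - 1 - d) ^ r) * x1 ^ (N - 1 - d)) | r.
        r \<le> cyc_card q N (N - 1 - d) - 1} =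
      {proj_vec (N - 1 - d) (\<xi> (N - 1 - d) ^ r) | r. r < cyc_card q N (N - 1 - d)}"
    unfolding proj_vec_def using le[of "N - 1 - d"] N_gt_1 by auto
  show ?thesis
    using basis_if_cyc_d_subset basis_if_not_cyc_d_subset
    unfolding image_Un affine proj image_insert image_empty proj_vec_def by auto
qed

end
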